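(* Let $\Gamma$ be a finite undirected graph without loops and with at most one edge between any two vertices. For each vertex $I$ of $\Gamma$ let $(G_I,P_I)$ be a quasi-lattice ordered group with a controlled map $\vartheta_I\colon(G_I,P_I)\to(\mathbb{Z}^{N_I},\mathbb{Z}_+^{N_I})$, and let $(G,P)$ be the graph product of the quasi-lattices $(G_I,P_I)$. If each $\vartheta_I$ has the minimality property, then so does the completion map $$\vartheta\colon(G,P)\to(\mathbb{Z}^N,\mathbb{Z}_+^N),\qquad N:=\sum_IN_I .$$
   Context: For a subsemigroup $P$ of a discrete group $G$ with $P\cap P^{-1}=\{e\}$ write $g\le h$ iff $g^{-1}h\in P$. $(G,P)$ is a quasi-lattice ordered group if any two $p,q\in G$ with a common upper bound in $P$ have a least common upper bound $p\vee q$ in $P$; write $p\vee q=\infty$ if $p,q$ have no common upper bound in $P$, and $p\vee q<\infty$ otherwise. In $(\mathbb{Z}^N,\mathbb{Z}_+^N)$ the order is coordinatewise. A controlled map $\vartheta\colon(G,P)\to(\mathbb{Z}^N,\mathbb{Z}_+^N)$ is an order preserving group homomorphism $G\to\mathbb{Z}^N$ such that $\vartheta|_P$ is finite-to-one, and $\vartheta(p)\vee\vartheta(q)=\vartheta(p\vee q)$ for all $p,q\in P$ with $p\vee q<\infty$. It has the minimality property if for every $\underline{m}\in\mathbb{Z}_+^N$, whenever $p\ne q$ are minimal elements of $\vartheta^{-1}([\underline{m},\infty]):=\{r\in P:\vartheta(r)\ge\underline{m}\}$, then $p\vee q=\infty$. Graph product: $G$ is the group generated by $\bigsqcup_{I\in\Gamma}G_I$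 (keeping the relations of each $G_I$), identifying the units $e_I$ and letting every element of $G_I$ commute with every element of $G_J$ whenever the distinct vertices $I$ and $J$ are adjacent; $P$ is the subsemigroup of $G$ generated by the $P_I$. The pair $(G,P)$ is a quasi-lattice ordered group (Crisp-Laca). The completion map is the homomorphism $\vartheta\colon G\to\mathbb{Z}^N=\bigoplus_I\mathbb{Z}^{N_I}$ whose restriction to each $G_I$ is $\vartheta_I$ followed by the inclusion $\mathbb{Z}^{N_I}\hookrightarrow\mathbb{Z}^N$ (that is, $G$ is mapped to the graph product $\bigoplus_IG_I$ over the complete graph on the vertices of $\Gamma$, and then $\bigoplus_I\vartheta_I$ is applied); it is a controlled map (Crisp-Laca). *)

theory Defs
  imports "HOL-Algebra.Algebra"
begin

section \<open>Quasi-lattice ordered groups\<close>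

definition ql_le :: "('a, 'b) monoid_scheme \<Rightarrow> 'a set \<Rightarrow> 'a \<Rightarrow> 'a \<Rightarrow> bool" where
  "ql_le G P g h \<longleftrightarrow> inv\<^bsub>G\<^esub> g \<otimes>\<^bsub>G\<^esub> h \<in> P"

definition ql_upper_bound :: "('a, 'b) monoid_scheme \<Rightarrow> 'a set \<Rightarrow> 'a \<Rightarrow> 'a \<Rightarrow> 'a \<Rightarrow> bool" where
  "ql_upper_bound G P p q r \<longleftrightarrow> r \<in> P \<and> ql_le G P p r \<and> ql_le G P q r"

definition ql_bounded :: "('a, 'b) monoid_scheme \<Rightarrow> 'a set \<Rightarrow> 'a \<Rightarrow> 'a \<Rightarrow> bool" where
  \<comment> \<open>the condition written \<open>p \<or> q < \<infinity>\<close>; its negation is \<open>p \<or> q = \<infinity>\<close>\<close>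
  "ql_bounded G P p q \<longleftrightarrow> (\<exists>r. ql_upper_bound G P p q r)"

definition ql_is_join :: "('a, 'b) monoid_scheme \<Rightarrow> 'a set \<Rightarrow> 'a \<Rightarrow> 'a \<Rightarrow> 'a \<Rightarrow> bool" where
  "ql_is_join G P p q r \<longleftrightarrow>
     ql_upper_bound G P p q r \<and> (\<forall>s. ql_upper_bound G P p q s \<longrightarrow> ql_le G P r s)"

definition ql_join :: "('a, 'b) monoid_scheme \<Rightarrow> 'a set \<Rightarrow> 'a \<Rightarrow> 'a \<Rightarrow> 'a" where
  "ql_join G P p q = (THE r. ql_is_join G P p q r)"

locale quasi_lattice_ordered = group G for G (structure) +
  fixes P :: "'a set"
  assumes cone_subset: "P \<subseteq> carrier G"
    and cone_mult_closed: "\<lbrakk>p \<in> P; q \<in> P\<rbrakk> \<Longrightarrow> p \<otimes> q \<in> P"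
    and cone_antisym: "P \<inter> (\<lambda>p. inv p) ` P = {\<one>}"
    and ex_join: "\<lbrakk>p \<in> carrier G; q \<in> carrier G; ql_bounded G P p q\<rbrakk>
                    \<Longrightarrow> \<exists>r. ql_is_join G P p q r"
begin

lemma ql_le_antisym:
  assumes "g \<in> carrier G" "h \<in> carrier G" "ql_le G P g h" "ql_le G P h g"
  shows "g = h"
proof -
  have "inv (inv h \<otimes> g) = inv g \<otimes> h"
    using assms by (simp add: inv_mult_group)
  then have "inv g \<otimes> h \<in> P \<inter> (\<lambda>p. inv p) ` P"
    using assms unfolding ql_le_def by (metis IntI imageI)
  then show ?thesis
    using assms cone_antisym by (metis inv_equality inv_inv inv_closed singletonD)
qed

lemma ql_join_is_join:
  assumes "p \<in> carrier G" "q \<in> carrier G" "ql_bounded G P p q"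
  shows "ql_is_join G P p q (ql_join G P p q)"
proof -
  obtain r where r: "ql_is_join G P p q r"
    using ex_join assms by blast
  have "s = r" if "ql_is_join G P p q s" for s
    using r that cone_subset ql_le_antisym
    unfolding ql_is_join_def ql_upper_bound_def by blast
  with r show ?thesis
    unfolding ql_join_def by (metis theI)
qed

end

section \<open>Integer lattices\<close>

text \<open>
  \<open>int_lattice K\<close> is the group of all integer vectors with coordinates indexed by \<open>K\<close>.  The
  group of integer \<open>n\<close>-vectors is \<open>int_lattice {..<n}\<close>, and a direct sum over \<open>I \<in> V\<close> of the
  groups \<open>int_lattice {..<N I}\<close> is \<open>int_lattice (SIGMA I:V. {..<N I})\<close>, whose number of
  coordinates is the sum of the \<open>N I\<close>.
\<close>

definition int_lattice :: "'k set \<Rightarrow> ('k \<Rightarrow> int) monoid" where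
  "int_lattice K = product_group K (\<lambda>_. integer_group)"

definition int_cone :: "'k set \<Rightarrow> ('k \<Rightarrow> int) set" where
  "int_cone K = {x \<in> carrier (int_lattice K). \<forall>k\<in>K. 0 \<le> x k}"

lemma carrier_int_lattice: "carrier (int_lattice K) = (\<Pi>\<^sub>E k\<in>K. UNIV)"
  by (simp add: int_lattice_def)

lemma group_int_lattice: "group (int_lattice K)"
  by (simp add: int_lattice_def)

lemma mult_int_lattice: "x \<otimes>\<^bsub>int_lattice K\<^esub> y = (\<lambda>k\<in>K. x k + y k)"
  by (simp add: int_lattice_def)

lemma ql_le_int_lattice:
  assumes "x \<in> carrier (int_lattice K)" "y \<in> carrier (int_lattice K)"
  shows "ql_le (int_lattice K) (int_cone K) x y \<longleftrightarrow> (\<forall>k\<in>K. x k \<le> y k)"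
proof -
  have "inv\<^bsub>int_lattice K\<^esub> x = (\<lambda>k\<in>K. - x k)"
    using assms by (simp add: int_lattice_def inv_product_group)
  then show ?thesis
    by (auto simp: ql_le_def int_cone_def mult_int_lattice carrier_int_lattice)
qed

lemma ql_is_join_int_lattice:
  assumes "x \<in> int_cone K" "y \<in> int_cone K"
  shows "ql_is_join (int_lattice K) (int_cone K) x y (\<lambda>k\<in>K. max (x k) (y k))"
proof -
  have c: "x \<in> carrier (int_lattice K)" "y \<in> carrier (int_lattice K)"
    using assms by (auto simp: int_cone_def)
  have m: "(\<lambda>k\<in>K. max (x k) (y k)) \<in> int_cone K"
    using assms by (auto simp: int_cone_def carrier_int_lattice le_max_iff_disj)
  then have mc: "(\<lambda>k\<in>K. max (x k) (y k)) \<in> carrier (int_lattice K)"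
    by (auto simp: int_cone_def)
  have ub: "ql_upper_bound (int_lattice K) (int_cone K) x y s \<longleftrightarrow>
          s \<in> int_cone K \<and> (\<forall>k\<in>K. x k \<le> s k) \<and> (\<forall>k\<in>K. y k \<le> s k)" for s
    using c ql_le_int_lattice[of x K s] ql_le_int_lattice[of y K s]
    unfolding ql_upper_bound_def by (auto simp: int_cone_def[THEN eqset_imp_iff])
  have "ql_le (int_lattice K) (int_cone K) (\<lambda>k\<in>K. max (x k) (y k)) s"
    if "ql_upper_bound (int_lattice K) (int_cone K) x y s" for s
  proof -
    have "s \<in> carrier (int_lattice K)"
      using that ub by (auto simp: int_cone_def)
    then show ?thesis
      using that mc ub by (simp add: ql_le_int_lattice)
  qed
  then show ?thesis
    using m ub by (auto simp: ql_is_join_def)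
qed

lemma card_direct_sum_coordinates:
  "finite V \<Longrightarrow> card (SIGMA I:V. {..<N I}) = (\<Sum>I\<in>V. N I)"
  by simp

section \<open>Controlled maps\<close>

definition controlled_map ::
  "('a, 'b) monoid_scheme \<Rightarrow> 'a set \<Rightarrow> 'k set \<Rightarrow> ('a \<Rightarrow> 'k \<Rightarrow> int) \<Rightarrow> bool" where
  "controlled_map G P K \<theta> \<longleftrightarrow>
     \<theta> \<in> hom G (int_lattice K) \<and>
     (\<forall>g\<in>carrier G. \<forall>h\<in>carrier G. ql_le G P g h \<longrightarrow>
        ql_le (int_lattice K) (int_cone K) (\<theta> g) (\<theta> h)) \<and>
     (\<forall>m. finite {p \<in> P. \<theta> p = m}) \<and>
     (\<forall>p\<in>P. \<forall>q\<in>P. ql_bounded G P p q \<longrightarrow>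
        ql_join (int_lattice K) (int_cone K) (\<theta> p) (\<theta> q) = \<theta> (ql_join G P p q))"

definition upper_preimage ::
  "'a set \<Rightarrow> 'k set \<Rightarrow> ('a \<Rightarrow> 'k \<Rightarrow> int) \<Rightarrow> ('k \<Rightarrow> int) \<Rightarrow> 'a set" where
  "upper_preimage P K \<theta> m = {r \<in> P. ql_le (int_lattice K) (int_cone K) m (\<theta> r)}"

definition ql_minimal :: "('a, 'b) monoid_scheme \<Rightarrow> 'a set \<Rightarrow> 'a set \<Rightarrow> 'a \<Rightarrow> bool" where
  "ql_minimal G P S p \<longleftrightarrow> p \<in> S \<and> (\<forall>s\<in>S. ql_le G P s p \<longrightarrow> s = p)"

definition minimality_property ::
  "('a, 'b) monoid_scheme \<Rightarrow> 'a set \<Rightarrow> 'k set \<Rightarrow> ('a \<Rightarrow> 'k \<Rightarrow> int) \<Rightarrow> bool" where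
  "minimality_property G P K \<theta> \<longleftrightarrow>
     (\<forall>m\<in>int_cone K. \<forall>p q.
        ql_minimal G P (upper_preimage P K \<theta> m) p \<and>
        ql_minimal G P (upper_preimage P K \<theta> m) q \<and> p \<noteq> q \<longrightarrow> \<not> ql_bounded G P p q)"

section \<open>Graph products\<close>

text \<open>
  The graph product is presented as a monoid, on the disjoint union of the vertex groups: words
  in letters \<open>(I, g)\<close> with \<open>g \<in> carrier (G I)\<close>, modulo the congruence generated by deleting
  units, multiplying neighbouring letters from the same vertex, and exchanging neighbouring
  letters from adjacent vertices.  The monoid so presented is a group (see \<open>group_graph_product\<close>),
  so it is also the group presented by these generators and relations.
\<close>

definition gp_words :: "'v set \<Rightarrow> ('v \<Rightarrow> ('a, 'b) monoid_scheme) \<Rightarrow> ('v \<times> 'a) list set" where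
  "gp_words V G = lists (SIGMA I:V. carrier (G I))"

inductive gp_eq ::
  "'v set \<Rightarrow> ('v \<times> 'v) set \<Rightarrow> ('v \<Rightarrow> ('a, 'b) monoid_scheme) \<Rightarrow>
   ('v \<times> 'a) list \<Rightarrow> ('v \<times> 'a) list \<Rightarrow> bool"
  for V E G where
  gp_refl: "w \<in> gp_words V G \<Longrightarrow> gp_eq V E G w w"
| gp_sym: "gp_eq V E G u v \<Longrightarrow> gp_eq V E G v u"
| gp_trans: "\<lbrakk>gp_eq V E G u v; gp_eq V E G v w\<rbrakk> \<Longrightarrow> gp_eq V E G u w"
| gp_unit: "\<lbrakk>u \<in> gp_words V G; v \<in> gp_words V G; I \<in> V\<rbrakk>
    \<Longrightarrow> gp_eq V E G (u @ [(I, \<one>\<^bsub>G I\<^esub>)] @ v) (u @ v)"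
| gp_mult: "\<lbrakk>u \<in> gp_words V G; v \<in> gp_words V G; I \<in> V; g \<in> carrier (G I); h \<in> carrier (G I)\<rbrakk>
    \<Longrightarrow> gp_eq V E G (u @ [(I, g), (I, h)] @ v) (u @ [(I, g \<otimes>\<^bsub>G I\<^esub> h)] @ v)"
| gp_comm: "\<lbrakk>u \<in> gp_words V G; v \<in> gp_words V G; I \<in> V; J \<in> V; (I, J) \<in> E;
      g \<in> carrier (G I); h \<in> carrier (G J)\<rbrakk>
    \<Longrightarrow> gp_eq V E G (u @ [(I, g), (J, h)] @ v) (u @ [(J, h), (I, g)] @ v)"

definition gp_rel ::
  "'v set \<Rightarrow> ('v \<times> 'v) set \<Rightarrow> ('v \<Rightarrow> ('a, 'b) monoid_scheme) \<Rightarrow>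
   (('v \<times> 'a) list \<times> ('v \<times> 'a) list) set" where
  "gp_rel V E G = {(u, v). gp_eq V E G u v}"

definition graph_product ::
  "'v set \<Rightarrow> ('v \<times> 'v) set \<Rightarrow> ('v \<Rightarrow> ('a, 'b) monoid_scheme) \<Rightarrow> ('v \<times> 'a) list set monoid" where
  "graph_product V E G =
     \<lparr>carrier = gp_words V G // gp_rel V E G,
      monoid.mult = (\<lambda>A B. \<Union>u\<in>A. \<Union>v\<in>B. gp_rel V E G `` {u @ v}),
      one = gp_rel V E G `` {[]}\<rparr>"

definition gp_incl ::
  "'v set \<Rightarrow> ('v \<times> 'v) set \<Rightarrow> ('v \<Rightarrow> ('a, 'b) monoid_scheme) \<Rightarrow> 'v \<Rightarrow> 'a \<Rightarrow> ('v \<times> 'a) list set"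
  where "gp_incl V E G I g = gp_rel V E G `` {[(I, g)]}"

inductive_set subsemigroup_generated :: "('a, 'b) monoid_scheme \<Rightarrow> 'a set \<Rightarrow> 'a set"
  for G S where
  incl: "s \<in> S \<Longrightarrow> s \<in> subsemigroup_generated G S"
| mult: "\<lbrakk>s \<in> subsemigroup_generated G S; t \<in> subsemigroup_generated G S\<rbrakk>
    \<Longrightarrow> s \<otimes>\<^bsub>G\<^esub> t \<in> subsemigroup_generated G S"

definition graph_product_cone ::
  "'v set \<Rightarrow> ('v \<times> 'v) set \<Rightarrow> ('v \<Rightarrow> ('a, 'b) monoid_scheme) \<Rightarrow> ('v \<Rightarrow> 'a set) \<Rightarrow>
   ('v \<times> 'a) list set set" where
  "graph_product_cone V E G P =
     subsemigroup_generated (graph_product V E G) (\<Union>I\<in>V. gp_incl V E G I ` P I)"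

definition lattice_incl ::
  "'v set \<Rightarrow> ('v \<Rightarrow> nat) \<Rightarrow> 'v \<Rightarrow> (nat \<Rightarrow> int) \<Rightarrow> 'v \<times> nat \<Rightarrow> int" where
  "lattice_incl V N I x = (\<lambda>(J, k)\<in>(SIGMA J:V. {..<N J}). if J = I then x k else 0)"

text \<open>
  The completion map exists and its values on the graph product are uniquely determined by this
  predicate (see \<open>ex_completion_map\<close> and \<open>completion_map_unique\<close>).
\<close>

definition completion_map ::
  "'v set \<Rightarrow> ('v \<times> 'v) set \<Rightarrow> ('v \<Rightarrow> ('a, 'b) monoid_scheme) \<Rightarrow> ('v \<Rightarrow> nat) \<Rightarrow>
   ('v \<Rightarrow> 'a \<Rightarrow> nat \<Rightarrow> int) \<Rightarrow> (('v \<times> 'a) list set \<Rightarrow> 'v \<times> nat \<Rightarrow> int) \<Rightarrow> bool" where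
  "completion_map V E G N \<theta> \<Theta> \<longleftrightarrow>
     \<Theta> \<in> hom (graph_product V E G) (int_lattice (SIGMA I:V. {..<N I})) \<and>
     (\<forall>I\<in>V. \<forall>g\<in>carrier (G I). \<Theta> (gp_incl V E G I g) = lattice_incl V N I (\<theta> I g))"

subsection \<open>Well-definedness\<close>

locale group_family =
  fixes V :: "'v set" and E :: "('v \<times> 'v) set" and G :: "'v \<Rightarrow> ('a, 'b) monoid_scheme"
  assumes groups: "\<And>I. I \<in> V \<Longrightarrow> group (G I)"
begin

lemma gp_words_append: "u @ v \<in> gp_words V G \<longleftrightarrow> u \<in> gp_words V G \<and> v \<in> gp_words V G"
  by (auto simp: gp_words_def)

lemma gp_words_Cons:
  "(I, g) # v \<in> gp_words V G \<longleftrightarrow> I \<in> V \<and> g \<in> carrier (G I) \<and> v \<in> gp_words V G"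
  by (auto simp: gp_words_def)

lemma gp_words_Nil: "[] \<in> gp_words V G"
  by (auto simp: gp_words_def)

lemmas gp_words_simps = gp_words_append gp_words_Cons gp_words_Nil

lemma gp_eq_words: "gp_eq V E G u v \<Longrightarrow> u \<in> gp_words V G \<and> v \<in> gp_words V G"
proof (induction rule: gp_eq.induct)
  case (gp_mult u v I g h)
  then interpret group "G I" using groups by simp
  show ?case using gp_mult by (simp add: gp_words_simps)
next
  case (gp_unit u v I)
  then interpret group "G I" using groups by simp
  show ?case using gp_unit by (simp add: gp_words_simps)
qed (auto simp: gp_words_simps)

lemma equiv_gp_rel: "equiv (gp_words V G) (gp_rel V E G)"
proof (rule equivI)
  show "gp_rel V E G \<subseteq> gp_words V G \<times> gp_words V G"
    using gp_eq_words by (auto simp: gp_rel_def)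
  show "refl_on (gp_words V G) (gp_rel V E G)"
    using gp_refl by (fastforce simp: gp_rel_def refl_on_def)
  show "sym (gp_rel V E G)"
    by (auto simp: gp_rel_def intro: symI gp_sym)
  show "trans (gp_rel V E G)"
    by (auto simp: gp_rel_def intro: transI gp_trans)
qed

lemma gp_eq_append_context:
  assumes "gp_eq V E G u v" "a \<in> gp_words V G" "b \<in> gp_words V G"
  shows "gp_eq V E G (a @ u @ b) (a @ v @ b)"
  using assms
proof (induction rule: gp_eq.induct)
  case (gp_refl w) then show ?case by (simp add: gp_words_simps gp_eq.gp_refl)
next
  case (gp_sym u v) then show ?case by (simp add: gp_eq.gp_sym)
next
  case (gp_trans u v w) then show ?case by (blast intro: gp_eq.gp_trans)
next
  case (gp_unit u v I)
  then show ?case using gp_eq.gp_unit[of "a @ u" V G "v @ b" I E] by (simp add: gp_words_simps)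
next
  case (gp_mult u v I g h)
  then show ?case
    using gp_eq.gp_mult[of "a @ u" V G "v @ b" I g h E] by (simp add: gp_words_simps)
next
  case (gp_comm u v I J g h)
  then show ?case
    using gp_eq.gp_comm[of "a @ u" V G "v @ b" I J E g h] by (simp add: gp_words_simps)
qed

lemma gp_eq_append:
  assumes "gp_eq V E G u u'" "gp_eq V E G v v'"
  shows "gp_eq V E G (u @ v) (u' @ v')"
proof -
  have "gp_eq V E G (u @ v) (u' @ v)"
    using gp_eq_append_context[OF assms(1), of "[]" v] gp_eq_words[OF assms(2)]
    by (simp add: gp_words_simps)
  moreover have "gp_eq V E G (u' @ v) (u' @ v')"
    using gp_eq_append_context[OF assms(2), of u' "[]"] gp_eq_words[OF assms(1)]
    by (simp add: gp_words_simps)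
  ultimately show ?thesis by (rule gp_trans)
qed

abbreviation gp_class :: "('v \<times> 'a) list \<Rightarrow> ('v \<times> 'a) list set" where
  "gp_class w \<equiv> gp_rel V E G `` {w}"

lemma gp_class_eq: "gp_eq V E G u v \<Longrightarrow> gp_class u = gp_class v"
  by (rule equiv_class_eq[OF equiv_gp_rel]) (simp add: gp_rel_def)

lemma carrier_graph_product: "carrier (graph_product V E G) = gp_class ` gp_words V G"
  by (auto simp: graph_product_def quotient_def)

lemma one_graph_product: "\<one>\<^bsub>graph_product V E G\<^esub> = gp_class []"
  by (simp add: graph_product_def)

lemma mult_graph_product:
  assumes "u \<in> gp_words V G" "v \<in> gp_words V G"
  shows "gp_class u \<otimes>\<^bsub>graph_product V E G\<^esub> gp_class v = gp_class (u @ v)"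
proof -
  have "gp_class (u' @ v') = gp_class (u @ v)" if "u' \<in> gp_class u" "v' \<in> gp_class v" for u' v'
    using that gp_eq_append[of u u' v v'] gp_class_eq by (auto simp: gp_rel_def)
  moreover have "u \<in> gp_class u" "v \<in> gp_class v"
    using assms by (auto simp: gp_rel_def gp_refl)
  ultimately have "(\<Union>u'\<in>gp_class u. \<Union>v'\<in>gp_class v. gp_class (u' @ v')) = gp_class (u @ v)"
    by blast
  then show ?thesis
    by (simp add: graph_product_def)
qed

lemma group_graph_product: "group (graph_product V E G)"
proof (rule groupI)
  show "\<one>\<^bsub>graph_product V E G\<^esub> \<in> carrier (graph_product V E G)"
    by (auto simp: one_graph_product carrier_graph_product gp_words_simps)
next
  fix A B assume "A \<in> carrier (graph_product V E G)" "B \<in> carrier (graph_product V E G)"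
  then show "A \<otimes>\<^bsub>graph_product V E G\<^esub> B \<in> carrier (graph_product V E G)"
    by (auto simp: carrier_graph_product mult_graph_product gp_words_simps)
next
  fix A B C assume "A \<in> carrier (graph_product V E G)" "B \<in> carrier (graph_product V E G)"
    "C \<in> carrier (graph_product V E G)"
  then show "A \<otimes>\<^bsub>graph_product V E G\<^esub> B \<otimes>\<^bsub>graph_product V E G\<^esub> C =
      A \<otimes>\<^bsub>graph_product V E G\<^esub> (B \<otimes>\<^bsub>graph_product V E G\<^esub> C)"
    by (auto simp: carrier_graph_product mult_graph_product gp_words_simps)
next
  fix A assume "A \<in> carrier (graph_product V E G)"
  then show "\<one>\<^bsub>graph_product V E G\<^esub> \<otimes>\<^bsub>graph_product V E G\<^esub> A = A"
    by (auto simp: carrier_graph_product one_graph_product mult_graph_product gp_words_simps)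
next
  have *: "\<exists>v\<in>gp_words V G. gp_eq V E G (v @ w) []" if "w \<in> gp_words V G" for w
    using that
  proof (induction w)
    case Nil
    then show ?case by (auto intro!: bexI[of _ "[]"] gp_refl simp: gp_words_simps)
  next
    case (Cons x w)
    obtain I g where x: "x = (I, g)" by (cases x)
    with Cons.prems have I: "I \<in> V" "g \<in> carrier (G I)" "w \<in> gp_words V G"
      by (auto simp: gp_words_simps)
    then interpret group "G I" using groups by simp
    obtain v where v: "v \<in> gp_words V G" "gp_eq V E G (v @ w) []"
      using Cons.IH I by blast
    have "gp_eq V E G (v @ [(I, inv\<^bsub>G I\<^esub> g), (I, g)] @ w) (v @ [(I, \<one>\<^bsub>G I\<^esub>)] @ w)"
      using gp_mult[of v V G w I "inv\<^bsub>G I\<^esub> g" g E] I v by simp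
    moreover have "gp_eq V E G (v @ [(I, \<one>\<^bsub>G I\<^esub>)] @ w) (v @ w)"
      using gp_unit[of v V G w I E] I v by simp
    ultimately have "gp_eq V E G ((v @ [(I, inv\<^bsub>G I\<^esub> g)]) @ x # w) []"
      using gp_trans[OF _ gp_trans[OF _ v(2)]] x by simp
    moreover have "v @ [(I, inv\<^bsub>G I\<^esub> g)] \<in> gp_words V G"
      using v I by (simp add: gp_words_simps)
    ultimately show ?case by blast
  qed
  fix A assume "A \<in> carrier (graph_product V E G)"
  then obtain w where w: "w \<in> gp_words V G" "A = gp_class w"
    by (auto simp: carrier_graph_product)
  with * obtain v where v: "v \<in> gp_words V G" "gp_eq V E G (v @ w) []" by blast
  show "\<exists>B\<in>carrier (graph_product V E G).
      B \<otimes>\<^bsub>graph_product V E G\<^esub> A = \<one>\<^bsub>graph_product V E G\<^esub>"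
    using v w gp_class_eq
    by (auto intro!: bexI[of _ "gp_class v"]
        simp: mult_graph_product one_graph_product carrier_graph_product)
qed

lemma gp_incl_hom: "I \<in> V \<Longrightarrow> gp_incl V E G I \<in> hom (G I) (graph_product V E G)"
proof (rule homI)
  fix g assume "I \<in> V" "g \<in> carrier (G I)"
  then show "gp_incl V E G I g \<in> carrier (graph_product V E G)"
    by (auto simp: gp_incl_def carrier_graph_product gp_words_simps)
next
  fix g h assume "I \<in> V" "g \<in> carrier (G I)" "h \<in> carrier (G I)"
  then show "gp_incl V E G I (g \<otimes>\<^bsub>G I\<^esub> h) =
      gp_incl V E G I g \<otimes>\<^bsub>graph_product V E G\<^esub> gp_incl V E G I h"
    using gp_class_eq[OF gp_mult[of "[]" V G "[]" I g h E]]
    by (simp add: gp_incl_def mult_graph_product gp_words_simps)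
qed

lemma completion_map_unique:
  assumes "completion_map V E G N \<theta> \<Theta>" "completion_map V E G N \<theta> \<Theta>'"
    and "A \<in> carrier (graph_product V E G)"
  shows "\<Theta> A = \<Theta>' A"
proof -
  interpret L: group "int_lattice (SIGMA I:V. {..<N I})" by (rule group_int_lattice)
  interpret G: group "graph_product V E G" by (rule group_graph_product)
  have h: "\<Theta> \<in> hom (graph_product V E G) (int_lattice (SIGMA I:V. {..<N I}))"
    "\<Theta>' \<in> hom (graph_product V E G) (int_lattice (SIGMA I:V. {..<N I}))"
    using assms by (auto simp: completion_map_def)
  have "\<Theta> (gp_class w) = \<Theta>' (gp_class w)" if "w \<in> gp_words V G" for w
    using that
  proof (induction w)
    case Nil
    then show ?case
      using hom_one[OF h(1)] hom_one[OF h(2)] G.is_group L.is_group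
      by (simp add: one_graph_product)
  next
    case (Cons x w)
    obtain I g where x: "x = (I, g)" by (cases x)
    with Cons.prems have I: "I \<in> V" "g \<in> carrier (G I)" "w \<in> gp_words V G"
      by (auto simp: gp_words_simps)
    have eq: "gp_class (x # w) = gp_incl V E G I g \<otimes>\<^bsub>graph_product V E G\<^esub> gp_class w"
      using I x by (simp add: gp_incl_def mult_graph_product gp_words_simps)
    have c: "gp_incl V E G I g \<in> carrier (graph_product V E G)"
        "gp_class w \<in> carrier (graph_product V E G)"
      using I by (auto simp: gp_incl_def carrier_graph_product gp_words_simps)
    have "\<Theta> (gp_incl V E G I g) = \<Theta>' (gp_incl V E G I g)"
      using assms I by (simp add: completion_map_def)
    with Cons.IH I show ?case
      unfolding eq hom_mult[OF h(1) c] hom_mult[OF h(2) c] by simp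
  qed
  then show ?thesis
    using assms(3) by (auto simp: carrier_graph_product)
qed

lemma ex_completion_map:
  assumes \<theta>: "\<And>I. I \<in> V \<Longrightarrow> \<theta> I \<in> hom (G I) (int_lattice {..<N I})"
  shows "\<exists>\<Theta>. completion_map V E G N \<theta> \<Theta>"
proof -
  let ?K = "SIGMA I:V. {..<N I}"
  define f where "f w = (\<lambda>(J, k)\<in>?K. \<Sum>(I, g)\<leftarrow>w. if J = I then \<theta> I g k else 0)" for w
  have mul: "\<theta> I (g \<otimes>\<^bsub>G I\<^esub> h) k = \<theta> I g k + \<theta> I h k"
    if "I \<in> V" "g \<in> carrier (G I)" "h \<in> carrier (G I)" "k < N I" for I g h k
    using hom_mult[OF \<theta>, of I g h] that by (simp add: mult_int_lattice)
  have one: "\<theta> I \<one>\<^bsub>G I\<^esub> k = 0" if "I \<in> V" "k < N I" for I k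
    using mul[of I "\<one>\<^bsub>G I\<^esub>" "\<one>\<^bsub>G I\<^esub>" k] groups[of I] that
    by (simp add: group.is_monoid monoid.l_one)
  have f_eq: "f u = f v" if "gp_eq V E G u v" for u v
    using that
  proof (induction rule: gp_eq.induct)
    case (gp_unit u v I)
    then show ?case by (auto simp: f_def one intro!: restrict_ext)
  next
    case (gp_mult u v I g h)
    then show ?case by (auto simp: f_def mul intro!: restrict_ext)
  next
    case (gp_comm u v I J g h)
    then show ?case by (auto simp: f_def intro!: restrict_ext)
  qed auto
  define \<Theta> where "\<Theta> A = f (SOME w. w \<in> A)" for A
  have \<Theta>: "\<Theta> (gp_class w) = f w" if "w \<in> gp_words V G" for w
  proof -
    have "w \<in> gp_class w"
      using that by (simp add: gp_rel_def gp_refl)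
    then have "(SOME w'. w' \<in> gp_class w) \<in> gp_class w"
      by (rule someI)
    then have "gp_eq V E G w (SOME w'. w' \<in> gp_class w)"
      by (simp add: gp_rel_def)
    then show ?thesis
      using f_eq by (metis \<Theta>_def)
  qed
  have "\<Theta> \<in> hom (graph_product V E G) (int_lattice ?K)"
  proof (rule homI)
    fix A assume "A \<in> carrier (graph_product V E G)"
    then show "\<Theta> A \<in> carrier (int_lattice ?K)"
      by (auto simp: carrier_graph_product \<Theta> f_def carrier_int_lattice)
  next
    fix A B assume "A \<in> carrier (graph_product V E G)" "B \<in> carrier (graph_product V E G)"
    then obtain u v where "A = gp_class u" "B = gp_class v" "u \<in> gp_words V G" "v \<in> gp_words V G"
      by (auto simp: carrier_graph_product)
    then show "\<Theta> (A \<otimes>\<^bsub>graph_product V E G\<^esub> B) = \<Theta> A \<otimes>\<^bsub>int_lattice ?K\<^esub> \<Theta> B"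
      by (auto simp: mult_graph_product \<Theta> gp_words_simps mult_int_lattice f_def
          intro!: restrict_ext)
  qed
  moreover have "\<Theta> (gp_incl V E G I g) = lattice_incl V N I (\<theta> I g)"
    if "I \<in> V" "g \<in> carrier (G I)" for I g
    using that by (auto simp: gp_incl_def \<Theta> gp_words_simps f_def lattice_incl_def
        intro!: restrict_ext)
  ultimately show ?thesis
    unfolding completion_map_def by blast
qed

end

end

theory Submission
  imports Defs
begin

text \<open>
  In a set of the form \<open>upper_preimage P K \<theta> m\<close>, two distinct minimal elements are unbounded as
  soon as any two bounded elements \<open>p\<close>, \<open>q\<close> of the set have a common lower bound in it: if \<open>p\<close>
  and \<open>q\<close> are minimal, that lower bound equals both. For a single vertex the converse holds too
  (\<open>common_lower_bound\<close>), because a controlled map is finite-to-one and hence every element lies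
  above a minimal one. So the task is to pass from common lower bounds in the vertex monoids to
  common lower bounds in the graph product.

  Let \<open>p\<close> and \<open>q\<close> lie below \<open>r\<close>, and write \<open>r\<close> as a word of positive letters. If the word is
  suitable, then a left divisor of \<open>r\<close> is visible letter by letter: every letter \<open>x\<close> of the word
  is a product \<open>x = a b\<close> in its vertex monoid, the divisor is the product of the left parts \<open>a\<close>,
  and the complementary factor is the product of the right parts \<open>b\<close>. This needs a nontrivial
  \<open>b\<close> to commute past all later left parts, so a later left part is trivial unless its vertex is
  adjacent to that of \<open>b\<close>. Such a factorization is called a cut (\<open>cut_product\<close>). In particular,
  along the letters of one vertex \<open>I\<close> a cut is complete up to some letter, splits that letter,
  and is trivial afterwards.

  Given cuts of one and the same word for \<open>p\<close> and for \<open>q\<close>, the common lower bound is built at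
  each letter separately (\<open>common_lower_cut\<close>). If one of the two cuts is complete at a letter,
  the left part of the other is the smaller one, and is taken. If both are incomplete, then
  neither continues at that vertex, so both left parts alone carry what is still required there,
  and the minimality property of the vertex supplies a common lower bound of the two that meets
  the requirement (\<open>common_syllable\<close>).

  It remains to cut one word along both \<open>p\<close> and \<open>q\<close>. The factorizations \<open>r = p t = q t'\<close> give
  two words that have obvious cuts but need not be the same word. Cuts survive deleting units,
  merging neighbouring letters of a vertex, and exchanging letters of adjacent vertices, and
  these steps keep letters positive (\<open>cut_reduces\<close>); cuts need not survive splitting a letter in
  two. Hence the essential input is confluence: two words for the same element of the graph
  product can be brought to a common word by such steps alone (\<open>gp_eq_confluent\<close>). This is the
  normal form theorem for graph products, and is proved by van der Waerden's method, letting the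
  generators act on reduced words.
\<close>

section \<open>Words up to exchanging neighbouring letters\<close>

text \<open>
  For symmetric and irreflexive \<open>E\<close>, this is equality of traces, that is, of words modulo
  exchanging neighbouring letters of adjacent vertices, expressed by projections to pairs of
  vertices that are not adjacent. The pairs with \<open>I = J\<close> are among them. The description by
  projections makes it immediate that this is a congruence and that letters can be cancelled;
  \<open>trace_eq_Cons_move\<close> recovers the exchanges.
\<close>

definition trace_eq :: "('v \<times> 'v) set \<Rightarrow> ('v \<times> 'a) list \<Rightarrow> ('v \<times> 'a) list \<Rightarrow> bool" where
  "trace_eq E u v \<longleftrightarrow> (\<forall>I J. (I, J) \<notin> E \<longrightarrow>
     filter (\<lambda>x. fst x = I \<or> fst x = J) u = filter (\<lambda>x. fst x = I \<or> fst x = J) v)"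

lemma trace_eq_refl: "trace_eq E u u"
  by (simp add: trace_eq_def)

lemma trace_eq_sym: "trace_eq E u v \<Longrightarrow> trace_eq E v u"
  by (simp add: trace_eq_def)

lemma trace_eq_trans: "trace_eq E u v \<Longrightarrow> trace_eq E v w \<Longrightarrow> trace_eq E u w"
  by (simp add: trace_eq_def)

lemma trace_eq_Cons: "trace_eq E u v \<Longrightarrow> trace_eq E (x # u) (x # v)"
  by (simp add: trace_eq_def)

lemma trace_eq_mset:
  assumes "irrefl E" "trace_eq E u v"
  shows "mset u = mset v"
proof (rule multiset_eqI)
  fix x :: "'a \<times> 'b"
  have count: "count (mset w) x = count (mset (filter (\<lambda>y. fst y = fst x) w)) x" for w
    by (induction w) auto
  have "filter (\<lambda>y. fst y = fst x) u = filter (\<lambda>y. fst y = fst x) v"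
  proof -
    have "(fst x, fst x) \<notin> E"
      using assms(1) by (simp add: irrefl_def)
    then show ?thesis
      using assms(2) unfolding trace_eq_def by (metis (no_types, lifting) filter_cong)
  qed
  then show "count (mset u) x = count (mset v) x"
    by (metis count)
qed

lemma trace_eq_Cons_cancel:
  assumes "irrefl E" "trace_eq E (x # u) (y # v)" "fst x = fst y"
  shows "x = y" "trace_eq E u v"
proof -
  have "(fst x, fst x) \<notin> E"
    using assms(1) by (simp add: irrefl_def)
  with assms(2,3) show "x = y"
    unfolding trace_eq_def by fastforce
  show "trace_eq E u v"
    unfolding trace_eq_def
  proof (intro allI impI)
    fix I J assume "(I, J) \<notin> E"
    with assms(2) have "filter (\<lambda>x. fst x = I \<or> fst x = J) (x # u) =
        filter (\<lambda>x. fst x = I \<or> fst x = J) (y # v)"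
      unfolding trace_eq_def by blast
    with \<open>x = y\<close> show "filter (\<lambda>x. fst x = I \<or> fst x = J) u =
        filter (\<lambda>x. fst x = I \<or> fst x = J) v"
      by (simp split: if_splits)
  qed
qed

lemma trace_eq_move:
  assumes "irrefl E" "sym E" "\<forall>x\<in>set a. (fst y, fst x) \<in> E"
  shows "trace_eq E (a @ y # b) (y # a @ b)"
proof -
  have "filter (\<lambda>x. fst x = I \<or> fst x = J) a = []"
    if "(I, J) \<notin> E" "fst y = I \<or> fst y = J" for I J
    using assms that unfolding filter_empty_conv irrefl_def
    by (metis symD)
  then show ?thesis
    unfolding trace_eq_def by simp
qed

text \<open>
  A letter \<open>y\<close> in front of a trace can be found in every representing word behind letters that
  commute with it: the first letter of \<open>u\<close> whose vertex is not adjacent to that of \<open>y\<close> must be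
  \<open>y\<close> itself, since the projection of \<open>u\<close> to these two vertices begins with \<open>y\<close>.
\<close>

lemma trace_eq_Cons_move:
  assumes "irrefl E" "sym E" "trace_eq E u (y # v)"
  shows "\<exists>a b. u = a @ y # b \<and> (\<forall>x\<in>set a. (fst y, fst x) \<in> E) \<and> trace_eq E (a @ b) v"
proof -
  have "\<exists>a b. u = a @ y # b \<and> (\<forall>x\<in>set a. (fst y, fst x) \<in> E)"
    if "\<And>J. (fst y, J) \<notin> E \<Longrightarrow> \<exists>r. filter (\<lambda>x. fst x = fst y \<or> fst x = J) u = y # r"
    using that
  proof (induction u)
    case Nil
    then show ?case using assms(1) by (auto simp: irrefl_def)
  next
    case (Cons x u)
    show ?case
    proof (cases "x = y")
      case True
      then show ?thesis by (intro exI[of _ "[]"] exI[of _ u]) simp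
    next
      case False
      have adj: "(fst y, fst x) \<in> E"
        using Cons.prems[of "fst x"] False by auto
      then have ne: "fst x \<noteq> fst y"
        using assms(1) by (auto simp: irrefl_def)
      have "\<exists>r. filter (\<lambda>x. fst x = fst y \<or> fst x = J) u = y # r" if "(fst y, J) \<notin> E" for J
        using Cons.prems[OF that] adj ne that by (auto split: if_splits)
      then obtain a b where "u = a @ y # b" "\<forall>x\<in>set a. (fst y, fst x) \<in> E"
        using Cons.IH by blast
      then show ?thesis
        using adj by (intro exI[of _ "x # a"] exI[of _ b]) auto
    qed
  qed
  moreover have "\<exists>r. filter (\<lambda>x. fst x = fst y \<or> fst x = J) u = y # r" if "(fst y, J) \<notin> E" for J
    using assms(3) that unfolding trace_eq_def by simp
  ultimately obtain a b where ab: "u = a @ y # b" "\<forall>x\<in>set a. (fst y, fst x) \<in> E"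
    by blast
  then have "trace_eq E (y # a @ b) (y # v)"
    using trace_eq_move[OF assms(1,2) ab(2)] assms(3) trace_eq_sym trace_eq_trans by blast
  then show ?thesis
    using ab trace_eq_Cons_cancel[OF assms(1)] by blast
qed

lemma trace_eq_swap:
  assumes "irrefl E" "sym E" "(fst x, fst y) \<in> E"
  shows "trace_eq E (x # y # u) (y # x # u)"
  using trace_eq_move[OF assms(1,2), of "[x]" y u] assms by (auto dest: symD)

text \<open>
  Levi's lemma for traces: two different first letters commute, and each is a first letter of
  what the other one leaves.
\<close>

lemma trace_eq_exchange:
  assumes "irrefl E" "sym E" "trace_eq E (x # u) (y # v)" "fst x \<noteq> fst y"
  shows "(fst x, fst y) \<in> E \<and> (\<exists>w. trace_eq E u (y # w) \<and> trace_eq E v (x # w))"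
proof -
  obtain a b where ab: "x # u = a @ y # b" "\<forall>z\<in>set a. (fst y, fst z) \<in> E" "trace_eq E (a @ b) v"
    using trace_eq_Cons_move[OF assms(1-3)] by blast
  with assms(4) obtain a' where a': "a = x # a'" "u = a' @ y # b"
    by (cases a) auto
  then have "trace_eq E u (y # a' @ b)"
    using trace_eq_move[OF assms(1,2), of a' y b] ab by simp
  moreover have "trace_eq E v (x # a' @ b)"
    using ab a' trace_eq_sym by auto
  ultimately show ?thesis
    using ab a' assms(2) by (auto dest: symD)
qed

definition can_begin :: "('v \<times> 'v) set \<Rightarrow> 'v \<Rightarrow> ('v \<times> 'a) list \<Rightarrow> bool" where
  "can_begin E I w \<longleftrightarrow> (\<exists>h z. trace_eq E w ((I, h) # z))"

lemma can_begin_cong: "trace_eq E u v \<Longrightarrow> can_begin E I u \<longleftrightarrow> can_begin E I v"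
  unfolding can_begin_def by (meson trace_eq_sym trace_eq_trans)

lemma can_begin_Cons:
  assumes "irrefl E" "sym E"
  shows "can_begin E I (x # u) \<longleftrightarrow> fst x = I \<or> ((fst x, I) \<in> E \<and> can_begin E I u)"
proof (cases "fst x = I")
  case True
  then show ?thesis
    unfolding can_begin_def by (metis prod.collapse trace_eq_refl)
next
  case False
  have "can_begin E I (x # u)" if "(fst x, I) \<in> E" "trace_eq E u ((I, h) # z)" for h z
  proof -
    have "trace_eq E (x # u) (x # (I, h) # z)"
      using that trace_eq_Cons by blast
    moreover have "trace_eq E (x # (I, h) # z) ((I, h) # x # z)"
      using trace_eq_swap[OF assms, of x "(I, h)"] that by simp
    ultimately show ?thesis
      unfolding can_begin_def using trace_eq_trans by blast
  qed
  moreover have "(fst x, I) \<in> E \<and> can_begin E I u" if "can_begin E I (x # u)"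
    using that trace_eq_exchange[OF assms, of x u "(I, _)"] False
    unfolding can_begin_def by fastforce
  ultimately show ?thesis
    using False unfolding can_begin_def by blast
qed

section \<open>Reduced words\<close>

locale graph_of_groups = group_family V E G
  for V :: "'v set" and E :: "('v \<times> 'v) set" and G :: "'v \<Rightarrow> ('a, 'b) monoid_scheme" +
  assumes symE: "sym E" and irreflE: "irrefl E"
begin

abbreviation "teq \<equiv> trace_eq E :: ('v \<times> 'a) list \<Rightarrow> _"

lemma teq_words: "teq u v \<Longrightarrow> u \<in> gp_words V G \<Longrightarrow> v \<in> gp_words V G"
  using trace_eq_mset[OF irreflE, of u v] by (auto simp: gp_words_def lists_eq_set dest!: mset_eq_setD)

text \<open>
  A word is reduced when it has no unit letters and no exchange brings two letters of the same
  vertex next to each other.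
\<close>

primrec reduced :: "('v \<times> 'a) list \<Rightarrow> bool" where
  "reduced [] \<longleftrightarrow> True"
| "reduced (x # w) \<longleftrightarrow> reduced w \<and> snd x \<noteq> \<one>\<^bsub>G (fst x)\<^esub> \<and> \<not> can_begin E (fst x) w"

text \<open>
  The induction is on the length because Levi's lemma replaces tails by equivalent words, which
  are not subwords of the given one.
\<close>

lemma reduced_cong: "reduced u \<Longrightarrow> teq u v \<Longrightarrow> reduced v"
proof (induction "length u" arbitrary: u v rule: less_induct)
  case less
  have same_length: "length u = length v"
    using trace_eq_mset[OF irreflE less.prems(2)] mset_eq_length by blast
  show ?case
  proof (cases v)
    case Nil
    then show ?thesis by simp
  next
    case v: (Cons y v')
    with same_length obtain x u' where u: "u = x # u'"
      by (cases u) auto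
    have red: "reduced u'" "snd x \<noteq> \<one>\<^bsub>G (fst x)\<^esub>" "\<not> can_begin E (fst x) u'"
      using less.prems u by auto
    show ?thesis
    proof (cases "fst x = fst y")
      case True
      then have "x = y" "teq u' v'"
        using trace_eq_Cons_cancel[OF irreflE] less.prems(2) u v by blast+
      then show ?thesis
        using less.hyps[of u' v'] red can_begin_cong u v by fastforce
    next
      case False
      then obtain w where w: "(fst x, fst y) \<in> E" "teq u' (y # w)" "teq v' (x # w)"
        using trace_eq_exchange[OF irreflE symE] less.prems(2) u v by blast
      have yw: "reduced (y # w)"
        using less.hyps[of u' "y # w"] u w red by simp
      have "\<not> can_begin E (fst x) w"
        using red(3) can_begin_cong[OF w(2)] can_begin_Cons[OF irreflE symE, of "fst x" y w] w(1)
        by (meson symD symE)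
      then have "reduced (x # w)"
        using yw red by simp
      moreover have "length (x # w) < length u"
        using same_length u v mset_eq_length[OF trace_eq_mset[OF irreflE w(2)]] by simp
      ultimately have "reduced v'"
        using less.hyps trace_eq_sym[OF w(3)] by blast
      moreover have "\<not> can_begin E (fst y) v'"
        using yw False can_begin_cong[OF w(3)] can_begin_Cons[OF irreflE symE, of "fst y" x w] by auto
      ultimately show ?thesis
        using yw v by simp
    qed
  qed
qed


text \<open>
  A reduced trace is the same as a group element \<open>h\<close> of the vertex \<open>I\<close> together with a reduced
  trace \<open>z\<close> that cannot begin with a letter of \<open>I\<close>; the element \<open>h\<close> is the unit exactly if the
  given trace cannot begin with a letter of \<open>I\<close> either. The predicate \<open>splits I h z w\<close> says that
  \<open>h\<close> and \<open>z\<close> belong to \<open>w\<close> in this way. The vertex group then acts on reduced traces through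
  multiplication of \<open>h\<close> from the left, which makes the relations of the vertex group evident.
\<close>

definition put :: "'v \<Rightarrow> 'a \<Rightarrow> ('v \<times> 'a) list \<Rightarrow> ('v \<times> 'a) list" where
  "put I h z = (if h = \<one>\<^bsub>G I\<^esub> then z else (I, h) # z)"

definition splits :: "'v \<Rightarrow> 'a \<Rightarrow> ('v \<times> 'a) list \<Rightarrow> ('v \<times> 'a) list \<Rightarrow> bool" where
  "splits I h z w \<longleftrightarrow> I \<in> V \<and> h \<in> carrier (G I) \<and> z \<in> gp_words V G \<and> reduced z \<and> \<not> can_begin E I z \<and>
     teq w (put I h z)"

lemma put_cong: "teq u v \<Longrightarrow> teq (put I h u) (put I h v)"
  by (simp add: put_def trace_eq_Cons)

lemma put_commute: "(I, J) \<in> E \<Longrightarrow> teq (put I h (put J k z)) (put J k (put I h z))"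
  using trace_eq_swap[OF irreflE symE, of "(I, h)" "(J, k)" z]
  by (simp add: put_def trace_eq_refl)

lemma can_begin_put_adjacent: "(I, J) \<in> E \<Longrightarrow> can_begin E J (put I h z) \<longleftrightarrow> can_begin E J z"
  using can_begin_Cons[OF irreflE symE, of J "(I, h)" z] irreflE
  by (auto simp: put_def irrefl_def)

lemma splits_cong: "splits I h z w \<Longrightarrow> teq w w' \<Longrightarrow> splits I h z w'"
  unfolding splits_def using trace_eq_sym trace_eq_trans by blast

lemma splits_put:
  assumes "I \<in> V" "h \<in> carrier (G I)" "z \<in> gp_words V G" "reduced z" "\<not> can_begin E I z"
  shows "splits I h z (put I h z)"
  using assms by (simp add: splits_def trace_eq_refl)

lemma splits_reduced:
  assumes "splits I h z w"
  shows "reduced w" "w \<in> gp_words V G"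
proof -
  have "reduced (put I h z)" "put I h z \<in> gp_words V G" "teq (put I h z) w"
    using assms unfolding splits_def by (auto simp: put_def gp_words_simps intro: trace_eq_sym)
  then show "reduced w" "w \<in> gp_words V G"
    using reduced_cong teq_words by blast+
qed

lemma ex_splits:
  assumes "I \<in> V" "w \<in> gp_words V G" "reduced w"
  shows "\<exists>h z. splits I h z w"
proof (cases "can_begin E I w")
  case True
  then obtain h z where z: "teq w ((I, h) # z)"
    unfolding can_begin_def by blast
  then have "reduced ((I, h) # z)" "(I, h) # z \<in> gp_words V G"
    using assms reduced_cong teq_words by blast+
  then show ?thesis
    using z unfolding splits_def by (auto simp: put_def gp_words_simps intro!: exI[of _ h] exI[of _ z])
next
  case False
  interpret group "G I" using groups assms by blast
  show ?thesis
    using assms False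
    by (intro exI[of _ "\<one>\<^bsub>G I\<^esub>"] exI[of _ w]) (simp add: splits_def put_def trace_eq_refl)
qed

lemma splits_unique:
  assumes "splits I h z w" "splits I h' z' w"
  shows "h = h'" "teq z z'"
proof -
  have eq: "teq (put I h z) (put I h' z')"
    using assms unfolding splits_def by (meson trace_eq_sym trace_eq_trans)
  have nh: "\<not> can_begin E I z" "\<not> can_begin E I z'"
    using assms unfolding splits_def by blast+
  have "can_begin E I (put I h z) \<longleftrightarrow> h \<noteq> \<one>\<^bsub>G I\<^esub>" "can_begin E I (put I h' z') \<longleftrightarrow> h' \<noteq> \<one>\<^bsub>G I\<^esub>"
    using nh can_begin_Cons[OF irreflE symE, of I "(I, _)"] by (auto simp: put_def)
  then have same: "h = \<one>\<^bsub>G I\<^esub> \<longleftrightarrow> h' = \<one>\<^bsub>G I\<^esub>"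
    using can_begin_cong[OF eq] by blast
  have "h = h' \<and> teq z z'"
  proof (cases "h = \<one>\<^bsub>G I\<^esub>")
    case True
    then show ?thesis using same eq by (simp add: put_def)
  next
    case False
    then have "teq ((I, h) # z) ((I, h') # z')"
      using same eq by (simp add: put_def)
    then show ?thesis
      using trace_eq_Cons_cancel[OF irreflE, of "(I, h)" z "(I, h')" z'] by simp
  qed
  then show "h = h'" "teq z z'" by blast+
qed

text \<open>
  The choice is harmless: by \<open>splits_unique\<close> the result is determined up to \<open>teq\<close>.
\<close>

definition ins :: "'v \<Rightarrow> 'a \<Rightarrow> ('v \<times> 'a) list \<Rightarrow> ('v \<times> 'a) list" where
  "ins I g w = (SOME w'. \<exists>h z. splits I h z w \<and> w' = put I (g \<otimes>\<^bsub>G I\<^esub> h) z)"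

lemma splits_ins:
  assumes "splits I h z w" "g \<in> carrier (G I)"
  shows "splits I (g \<otimes>\<^bsub>G I\<^esub> h) z (ins I g w)"
proof -
  interpret group "G I" using groups assms(1) by (auto simp: splits_def)
  have "\<exists>h z. splits I h z w \<and> ins I g w = put I (g \<otimes>\<^bsub>G I\<^esub> h) z"
    unfolding ins_def by (rule someI_ex) (use assms in blast)
  then obtain h' z' where h': "splits I h' z' w" "ins I g w = put I (g \<otimes>\<^bsub>G I\<^esub> h') z'"
    by blast
  then have "h' = h" "teq z' z"
    using splits_unique assms by blast+
  with h' put_cong have "teq (ins I g w) (put I (g \<otimes>\<^bsub>G I\<^esub> h) z)"
    by simp
  then show ?thesis
    using assms unfolding splits_def by auto
qed

lemma splits_ins_teq: 
  assumes "splits I h z w" "g \<in> carrier (G I)"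
  shows "teq (ins I g w) (put I (g \<otimes>\<^bsub>G I\<^esub> h) z)"
  using splits_ins[OF assms] by (simp add: splits_def)

lemma ins_reduced:
  assumes "I \<in> V" "g \<in> carrier (G I)" "w \<in> gp_words V G" "reduced w"
  shows "ins I g w \<in> gp_words V G" "reduced (ins I g w)"
  using ex_splits[of I w] splits_ins splits_reduced assms by blast+

lemma ins_cong:
  assumes "I \<in> V" "g \<in> carrier (G I)" "w \<in> gp_words V G" "reduced w" "teq w w'"
  shows "teq (ins I g w) (ins I g w')"
proof -
  obtain h z where hz: "splits I h z w"
    using ex_splits assms by blast
  have "teq (put I (g \<otimes>\<^bsub>G I\<^esub> h) z) (ins I g w')"
    using splits_ins_teq[OF splits_cong[OF hz assms(5)] assms(2)] by (rule trace_eq_sym)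
  with splits_ins_teq[OF hz assms(2)] show ?thesis
    by (rule trace_eq_trans)
qed

lemma ins_one:
  assumes "I \<in> V" "w \<in> gp_words V G" "reduced w"
  shows "teq (ins I \<one>\<^bsub>G I\<^esub> w) w"
proof -
  interpret group "G I" using groups assms by blast
  obtain h z where hz: "splits I h z w"
    using ex_splits assms by blast
  then have "h \<in> carrier (G I)" "teq w (put I h z)"
    by (auto simp: splits_def)
  then show ?thesis
    using splits_ins_teq[OF hz, of "\<one>\<^bsub>G I\<^esub>"] trace_eq_sym trace_eq_trans by fastforce
qed

lemma ins_mult:
  assumes "I \<in> V" "w \<in> gp_words V G" "reduced w" "g \<in> carrier (G I)" "h \<in> carrier (G I)"
  shows "teq (ins I g (ins I h w)) (ins I (g \<otimes>\<^bsub>G I\<^esub> h) w)"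
proof -
  interpret group "G I" using groups assms by blast
  obtain k z where k: "splits I k z w" "k \<in> carrier (G I)"
    using ex_splits assms by (metis splits_def)
  have "teq (ins I g (ins I h w)) (put I (g \<otimes>\<^bsub>G I\<^esub> (h \<otimes>\<^bsub>G I\<^esub> k)) z)"
    using splits_ins_teq[OF splits_ins[OF k(1)]] assms by blast
  moreover have "teq (ins I (g \<otimes>\<^bsub>G I\<^esub> h) w) (put I (g \<otimes>\<^bsub>G I\<^esub> h \<otimes>\<^bsub>G I\<^esub> k) z)"
    using splits_ins_teq[OF k(1)] assms by blast
  ultimately show ?thesis
    using assms k m_assoc trace_eq_sym trace_eq_trans by metis
qed

text \<open>
  Adjacent vertices can be split off simultaneously: \<open>w\<close> is the product of a letter \<open>a\<close> of \<open>I\<close>,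
  a letter \<open>b\<close> of \<open>J\<close> and a rest \<open>y\<close> that begins with neither. The two actions change \<open>a\<close> and
  \<open>b\<close> independently.
\<close>

lemma ins_commute:
  assumes "I \<in> V" "J \<in> V" "(I, J) \<in> E" "w \<in> gp_words V G" "reduced w"
    and "g \<in> carrier (G I)" "h \<in> carrier (G J)"
  shows "teq (ins I g (ins J h w)) (ins J h (ins I g w))"
proof -
  interpret I: group "G I" using groups assms by blast
  interpret J: group "G J" using groups assms by blast
  have JI: "(J, I) \<in> E" using assms symE by (meson symD)
  obtain a z where a: "splits I a z w"
    using ex_splits assms by blast
  then have z: "z \<in> gp_words V G" "reduced z" "\<not> can_begin E I z" "a \<in> carrier (G I)"
      "teq w (put I a z)"
    by (auto simp: splits_def)
  obtain b y where b: "splits J b y z"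
    using ex_splits assms z by blast
  then have y: "y \<in> gp_words V G" "reduced y" "\<not> can_begin E J y" "b \<in> carrier (G J)"
      "teq z (put J b y)"
    by (auto simp: splits_def)
  have hy: "\<not> can_begin E I y"
    using z(3) can_begin_cong[OF y(5)] can_begin_put_adjacent[OF JI] by simp
  \<comment> \<open>the letters of both vertices can be split off independently, in either order\<close>
  have sp: "splits I c (put J d y) (put I c (put J d y))" 
       "splits J d (put I c y) (put I c (put J d y))"
    if "c \<in> carrier (G I)" "d \<in> carrier (G J)" for c d
  proof -
    have 1: "splits I c y (put I c y)" "splits J d y (put J d y)"
      using splits_put that assms y hy by blast+
    show "splits I c (put J d y) (put I c (put J d y))"
      using splits_put[OF assms(1) that(1)] splits_reduced[OF 1(2)] can_begin_put_adjacent[OF JI] hy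
      by simp
    have "splits J d (put I c y) (put J d (put I c y))"
      using splits_put[OF assms(2) that(2)] splits_reduced[OF 1(1)]
        can_begin_put_adjacent[OF assms(3)] y by simp
    then show "splits J d (put I c y) (put I c (put J d y))"
      using splits_cong put_commute[OF JI] by blast
  qed
  have w: "teq w (put I a (put J b y))"
    using z(5) put_cong[OF y(5)] trace_eq_trans by blast
  have "splits J b (put I a y) w" "splits I a (put J b y) w"
    using sp[of a b] z y splits_cong trace_eq_sym[OF w] by blast+
  then have i: "teq (ins J h w) (put J (h \<otimes>\<^bsub>G J\<^esub> b) (put I a y))"
      "teq (ins I g w) (put I (g \<otimes>\<^bsub>G I\<^esub> a) (put J b y))"
    using splits_ins_teq assms by blast+
  have "splits I a (put J (h \<otimes>\<^bsub>G J\<^esub> b) y) (ins J h w)"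
    using sp(1)[of a "h \<otimes>\<^bsub>G J\<^esub> b"] i(1) put_commute[OF JI] assms y z
    by (meson J.m_closed splits_cong trace_eq_sym trace_eq_trans)
  then have "teq (ins I g (ins J h w)) (put I (g \<otimes>\<^bsub>G I\<^esub> a) (put J (h \<otimes>\<^bsub>G J\<^esub> b) y))"
    using splits_ins_teq assms by blast
  moreover have "splits J b (put I (g \<otimes>\<^bsub>G I\<^esub> a) y) (ins I g w)"
    using sp(2)[of "g \<otimes>\<^bsub>G I\<^esub> a" b] i(2) assms y z
    by (meson I.m_closed splits_cong trace_eq_sym trace_eq_trans)
  then have "teq (ins J h (ins I g w)) (put J (h \<otimes>\<^bsub>G J\<^esub> b) (put I (g \<otimes>\<^bsub>G I\<^esub> a) y))"
    using splits_ins_teq assms by blast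
  ultimately show ?thesis
    using put_commute[OF JI] trace_eq_sym trace_eq_trans by blast
qed

section \<open>Confluence\<close>

definition nf :: "('v \<times> 'a) list \<Rightarrow> ('v \<times> 'a) list" where
  "nf u = foldr (\<lambda>(I, g). ins I g) u []"

lemma nf_reduced: "u \<in> gp_words V G \<Longrightarrow> nf u \<in> gp_words V G \<and> reduced (nf u)"
  by (induction u) (auto simp: nf_def gp_words_simps ins_reduced)

lemma nf_prefix_cong:
  assumes "u \<in> gp_words V G" "v \<in> gp_words V G" "v' \<in> gp_words V G" "teq (nf v) (nf v')"
  shows "teq (nf (u @ v)) (nf (u @ v'))"
  using assms(1)
proof (induction u)
  case Nil
  then show ?case using assms by simp
next
  case (Cons x u)
  then show ?case
    using assms ins_cong[of "fst x" "snd x" "nf (u @ v)" "nf (u @ v')"] nf_reduced[of "u @ v"]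
    by (cases x) (simp add: nf_def gp_words_simps)
qed

text \<open>
  The action of the letters on reduced traces satisfies the defining relations of the graph
  product, and \<open>nf u\<close> is the result of letting \<open>u\<close> act on the empty word.
\<close>

lemma nf_invariant: "gp_eq V E G u v \<Longrightarrow> teq (nf u) (nf v)"
proof (induction rule: gp_eq.induct)
  case (gp_unit u v I)
  then interpret group "G I" using groups by blast
  show ?case
    using gp_unit nf_reduced[of v] ins_one[of I "nf v"]
    by (intro nf_prefix_cong) (auto simp: gp_words_simps nf_def)
next
  case (gp_mult u v I g h)
  then interpret group "G I" using groups by blast
  show ?case
    using gp_mult nf_reduced[of v] ins_mult[of I "nf v" g h]
    by (intro nf_prefix_cong) (auto simp: gp_words_simps nf_def)
next
  case (gp_comm u v I J g h)
  then show ?case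
    using nf_reduced[of v] ins_commute[of I J "nf v" g h]
    by (intro nf_prefix_cong) (auto simp: gp_words_simps nf_def)
qed (auto intro: trace_eq_refl trace_eq_sym trace_eq_trans)

text \<open>
  The relations of the graph product, directed so that letters are deleted and merged but never
  inserted or split. Positivity of letters and cuts are therefore preserved.
\<close>

inductive gp_reduces :: "('v \<times> 'a) list \<Rightarrow> ('v \<times> 'a) list \<Rightarrow> bool" where
  reduces_refl: "gp_reduces w w"
| reduces_trans: "gp_reduces u v \<Longrightarrow> gp_reduces v w \<Longrightarrow> gp_reduces u w"
| reduces_unit: "gp_reduces (u @ [(I, \<one>\<^bsub>G I\<^esub>)] @ v) (u @ v)"
| reduces_mult: "gp_reduces (u @ [(I, g), (I, h)] @ v) (u @ [(I, g \<otimes>\<^bsub>G I\<^esub> h)] @ v)"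
| reduces_comm: "(I, J) \<in> E \<Longrightarrow> gp_reduces (u @ [(I, g), (J, h)] @ v) (u @ [(J, h), (I, g)] @ v)"

lemma reduces_prefix: "gp_reduces u v \<Longrightarrow> gp_reduces (a @ u) (a @ v)"
proof (induction rule: gp_reduces.induct)
  case (reduces_unit u I v)
  then show ?case using gp_reduces.reduces_unit[of "a @ u" I v] by simp
next
  case (reduces_mult u I g h v)
  then show ?case using gp_reduces.reduces_mult[of "a @ u" I g h v] by simp
next
  case (reduces_comm I J u g h v)
  then show ?case using gp_reduces.reduces_comm[of I J "a @ u" g h v] by simp
qed (auto intro: gp_reduces.reduces_refl gp_reduces.reduces_trans)

lemma reduces_Cons: "gp_reduces u v \<Longrightarrow> gp_reduces (x # u) (x # v)"
  using reduces_prefix[of u v "[x]"] by simp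

lemma reduces_move:
  "\<forall>x\<in>set a. (fst y, fst x) \<in> E \<Longrightarrow> gp_reduces (a @ y # b) (y # a @ b)"
proof (induction a)
  case Nil
  then show ?case by (simp add: reduces_refl)
next
  case (Cons x a)
  then have "gp_reduces (x # a @ y # b) (x # y # a @ b)"
    by (simp add: reduces_Cons)
  moreover have "gp_reduces (x # y # a @ b) (y # x # a @ b)"
    using reduces_comm[of "fst x" "fst y" "[]" "snd x" "snd y" "a @ b"] Cons.prems symE
    by (auto dest: symD)
  ultimately show ?case
    using reduces_trans by simp
qed

lemma teq_reduces: "teq u v \<Longrightarrow> gp_reduces u v"
proof (induction v arbitrary: u)
  case Nil
  then show ?case
    using trace_eq_mset[OF irreflE] reduces_refl by fastforce
next
  case (Cons y v)
  then obtain a b where "u = a @ y # b" "\<forall>x\<in>set a. (fst y, fst x) \<in> E" "teq (a @ b) v"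
    using trace_eq_Cons_move[OF irreflE symE] by blast
  then show ?case
    using Cons.IH reduces_Cons reduces_move reduces_trans by metis
qed

lemma ins_reduces:
  assumes "I \<in> V" "g \<in> carrier (G I)" "w \<in> gp_words V G" "reduced w"
  shows "gp_reduces ((I, g) # w) (ins I g w)"
proof -
  interpret group "G I" using groups assms by blast
  obtain h z where hz: "splits I h z w"
    using ex_splits assms by blast
  then have "gp_reduces w (put I h z)"
    using teq_reduces by (simp add: splits_def)
  then have "gp_reduces ((I, g) # w) ((I, g) # put I h z)"
    by (rule reduces_Cons)
  moreover have "gp_reduces ((I, g) # put I h z) ((I, g \<otimes>\<^bsub>G I\<^esub> h) # z)"
    using reduces_mult[of "[]" I g h z] assms reduces_refl by (auto simp: put_def)
  moreover have "gp_reduces ((I, g \<otimes>\<^bsub>G I\<^esub> h) # z) (put I (g \<otimes>\<^bsub>G I\<^esub> h) z)"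
    using reduces_unit[of "[]" I z] reduces_refl by (auto simp: put_def)
  moreover have "gp_reduces (put I (g \<otimes>\<^bsub>G I\<^esub> h) z) (ins I g w)"
    using teq_reduces trace_eq_sym splits_ins_teq[OF hz assms(2)] by blast
  ultimately show ?thesis
    using reduces_trans by blast
qed

lemma reduces_nf: "u \<in> gp_words V G \<Longrightarrow> gp_reduces u (nf u)"
proof (induction u)
  case Nil
  then show ?case by (simp add: nf_def reduces_refl)
next
  case (Cons x u)
  obtain I g where x: "x = (I, g)" by (cases x)
  then have "I \<in> V" "g \<in> carrier (G I)" "u \<in> gp_words V G"
    using Cons.prems by (auto simp: gp_words_simps)
  moreover from this have "gp_reduces (x # u) (x # nf u)"
    using Cons.IH reduces_Cons by blast
  ultimately show ?case
    using ins_reduces[of I g "nf u"] nf_reduced[of u] reduces_trans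
    by (simp add: x nf_def)
qed

text \<open>
  Both words reduce to their normal forms, and these differ only by exchanges.
\<close>

lemma gp_eq_confluent:
  assumes "gp_eq V E G u v"
  shows "\<exists>w. gp_reduces u w \<and> gp_reduces v w"
  using assms gp_eq_words reduces_nf nf_invariant teq_reduces reduces_trans by meson

end

section \<open>Quasi-lattices and controlled maps\<close>

context quasi_lattice_ordered
begin

lemma cone_one: "\<one> \<in> P"
  using cone_antisym by blast

lemma cone_carrier: "p \<in> P \<Longrightarrow> p \<in> carrier G"
  using cone_subset by blast

text \<open>
  A factorization of the unit in the cone is trivial, as its first factor lies in \<open>P\<close> and in the
  set of inverses of \<open>P\<close>.
\<close>

lemma cone_mult_eq_one:
  assumes "p \<in> P" "q \<in> P" "p \<otimes> q = \<one>"
  shows "p = \<one>" "q = \<one>"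
proof -
  have "p = inv q"
    using assms cone_carrier inv_equality by metis
  then have "p \<in> P \<inter> (\<lambda>p. inv p) ` P"
    using assms by blast
  then show "p = \<one>"
    using cone_antisym by blast
  then show "q = \<one>"
    using assms cone_carrier by simp
qed

lemma ql_le_iff:
  assumes "p \<in> carrier G" "q \<in> carrier G"
  shows "ql_le G P p q \<longleftrightarrow> (\<exists>t\<in>P. q = p \<otimes> t)"
proof
  assume "ql_le G P p q"
  then show "\<exists>t\<in>P. q = p \<otimes> t"
    using assms by (intro bexI[of _ "inv p \<otimes> q"]) (auto simp: ql_le_def m_assoc[symmetric])
next
  assume "\<exists>t\<in>P. q = p \<otimes> t"
  then show "ql_le G P p q"
    using assms cone_carrier by (auto simp: ql_le_def m_assoc[symmetric])
qed

lemma ql_le_refl: "p \<in> carrier G \<Longrightarrow> ql_le G P p p"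
  using cone_one by (simp add: ql_le_def)

lemma ql_le_trans:
  assumes "p \<in> carrier G" "q \<in> carrier G" "r \<in> carrier G" "ql_le G P p q" "ql_le G P q r"
  shows "ql_le G P p r"
proof -
  obtain s where s: "s \<in> P" "q = p \<otimes> s"
    using assms(4) ql_le_iff[OF assms(1,2)] by blast
  obtain t where t: "t \<in> P" "r = q \<otimes> t"
    using assms(5) ql_le_iff[OF assms(2,3)] by blast
  have "r = p \<otimes> (s \<otimes> t)"
    using s t assms(1) cone_carrier by (simp add: m_assoc)
  moreover have "s \<otimes> t \<in> P"
    using s t cone_mult_closed by blast
  ultimately show ?thesis
    using ql_le_iff[OF assms(1,3)] by blast
qed

end

locale controlled_quasi_lattice = quasi_lattice_ordered G P
  for G :: "('a, 'b) monoid_scheme" (structure) and P :: "'a set" +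
  fixes K :: "'k set" and \<theta> :: "'a \<Rightarrow> 'k \<Rightarrow> int"
  assumes finite_coordinates: "finite K" and controlled: "controlled_map G P K \<theta>"
begin

lemma theta_hom: "\<theta> \<in> hom G (int_lattice K)"
  using controlled by (simp add: controlled_map_def)

lemma theta_carrier: "p \<in> carrier G \<Longrightarrow> \<theta> p \<in> carrier (int_lattice K)"
  using hom_in_carrier[OF theta_hom] .

lemma theta_mult:
  "\<lbrakk>p \<in> carrier G; q \<in> carrier G; k \<in> K\<rbrakk> \<Longrightarrow> \<theta> (p \<otimes> q) k = \<theta> p k + \<theta> q k"
  using hom_mult[OF theta_hom, of p q] by (simp add: mult_int_lattice)

lemma theta_one: "k \<in> K \<Longrightarrow> \<theta> \<one> k = 0"
  using theta_mult[of \<one> \<one> k] by simp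

lemma theta_mono:
  assumes "p \<in> carrier G" "q \<in> carrier G" "ql_le G P p q" "k \<in> K"
  shows "\<theta> p k \<le> \<theta> q k"
  using controlled assms ql_le_int_lattice[OF theta_carrier theta_carrier, of p q]
  unfolding controlled_map_def by blast

lemma theta_nonneg: "p \<in> P \<Longrightarrow> k \<in> K \<Longrightarrow> 0 \<le> \<theta> p k"
  using theta_mono[of \<one> p k] theta_one[of k] cone_carrier by (simp add: ql_le_def)

lemma in_upper_preimage:
  assumes "m \<in> int_cone K"
  shows "r \<in> upper_preimage P K \<theta> m \<longleftrightarrow> r \<in> P \<and> (\<forall>k\<in>K. m k \<le> \<theta> r k)"
  using assms ql_le_int_lattice[of m K "\<theta> r"] theta_carrier[OF cone_carrier, of r]
  by (auto simp: upper_preimage_def int_cone_def)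

text \<open>
  The values of \<open>\<theta>\<close> on the elements below \<open>a\<close> lie in the box between \<open>0\<close> and \<open>\<theta> a\<close>, which has
  finitely many points, each with finitely many preimages.
\<close>

lemma finite_lower_set:
  assumes "a \<in> P"
  shows "finite {r \<in> P. ql_le G P r a}"
proof (rule finite_subset)
  show "{r \<in> P. ql_le G P r a} \<subseteq> (\<Union>m\<in>(\<Pi>\<^sub>E k\<in>K. {0..\<theta> a k}). {p \<in> P. \<theta> p = m})"
  proof
    fix r assume r: "r \<in> {r \<in> P. ql_le G P r a}"
    then have "\<theta> r k \<in> {0..\<theta> a k}" if "k \<in> K" for k
      using theta_mono theta_nonneg assms cone_carrier that by auto
    then have "\<theta> r \<in> (\<Pi>\<^sub>E k\<in>K. {0..\<theta> a k})"
      using theta_carrier[of r] r cone_carrier by (auto simp: carrier_int_lattice PiE_iff)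
    with r show "r \<in> (\<Union>m\<in>(\<Pi>\<^sub>E k\<in>K. {0..\<theta> a k}). {p \<in> P. \<theta> p = m})"
      by blast
  qed
  show "finite (\<Union>m\<in>(\<Pi>\<^sub>E k\<in>K. {0..\<theta> a k}). {p \<in> P. \<theta> p = m})"
    using controlled finite_coordinates
    by (intro finite_UN_I finite_PiE) (auto simp: controlled_map_def)
qed

lemma ex_minimal_below:
  assumes "a \<in> S" "S \<subseteq> P"
  shows "\<exists>s. ql_minimal G P S s \<and> ql_le G P s a"
proof -
  \<comment> \<open>an element of \<open>S\<close> below \<open>a\<close> with the fewest elements of the cone below it is minimal\<close>
  let ?down = "\<lambda>r. {t \<in> P. ql_le G P t r}"
  let ?B = "\<lambda>s. s \<in> S \<and> ql_le G P s a"
  have "?B a"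
    using assms ql_le_refl cone_carrier by auto
  then obtain s where s: "?B s" "\<And>t. ?B t \<Longrightarrow> card (?down s) \<le> card (?down t)"
    using ex_has_least_nat[of ?B a "\<lambda>t. card (?down t)"] by blast
  have "t = s" if t: "t \<in> S" "ql_le G P t s" for t
  proof (rule ccontr)
    assume "t \<noteq> s"
    have c: "t \<in> carrier G" "s \<in> carrier G" "a \<in> carrier G"
      using assms s t cone_carrier by auto
    then have "s \<notin> ?down t"
      using \<open>t \<noteq> s\<close> t ql_le_antisym by blast
    moreover have "s \<in> ?down s"
      using assms s ql_le_refl c by auto
    moreover have "?down t \<subseteq> ?down s"
      using ql_le_trans c t cone_carrier by blast
    ultimately have "card (?down t) < card (?down s)"
      using finite_lower_set[of s] assms s by (intro psubset_card_mono) auto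
    moreover have "?B t"
      using ql_le_trans c t s by blast
    ultimately show False
      using s(2) by fastforce
  qed
  with s show ?thesis
    unfolding ql_minimal_def by blast
qed

text \<open>
  Minimal elements below \<open>a\<close> and below \<open>a'\<close> are bounded by \<open>a b = a' b'\<close>, hence equal by the
  minimality property. The requirement \<open>m\<close> may have negative coordinates, which occur once
  earlier letters have more than met what is asked for; they can be replaced by \<open>0\<close> because \<open>\<theta>\<close>
  is nonnegative on \<open>P\<close>.
\<close>

lemma common_lower_bound:
  assumes "minimality_property G P K \<theta>"
    and "a \<in> P" "b \<in> P" "a' \<in> P" "b' \<in> P" "a \<otimes> b = a' \<otimes> b'"
    and "\<forall>k\<in>K. m k \<le> \<theta> a k" "\<forall>k\<in>K. m k \<le> \<theta> a' k"
  shows "\<exists>s\<in>P. ql_le G P s a \<and> ql_le G P s a' \<and> (\<forall>k\<in>K. m k \<le> \<theta> s k)"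
proof -
  let ?m = "\<lambda>k\<in>K. max 0 (m k)"
  let ?S = "upper_preimage P K \<theta> ?m"
  have m: "?m \<in> int_cone K"
    by (auto simp: int_cone_def carrier_int_lattice)
  have S: "?S \<subseteq> P" "a \<in> ?S" "a' \<in> ?S"
    using assms theta_nonneg in_upper_preimage[OF m] by auto
  obtain s where s: "ql_minimal G P ?S s" "ql_le G P s a"
    using ex_minimal_below[OF S(2,1)] by blast
  obtain s' where s': "ql_minimal G P ?S s'" "ql_le G P s' a'"
    using ex_minimal_below[OF S(3,1)] by blast
  have sS: "s \<in> ?S" "s' \<in> ?S"
    using s s' unfolding ql_minimal_def by blast+
  then have sP: "s \<in> P" "s' \<in> P"
    using S(1) by blast+
  have c: "a \<in> carrier G" "a' \<in> carrier G" "s \<in> carrier G" "s' \<in> carrier G" "a \<otimes> b \<in> carrier G"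
    using assms(2-5) sP cone_carrier by auto
  have "ql_le G P a (a \<otimes> b)" "ql_le G P a' (a \<otimes> b)"
    using ql_le_iff[OF c(1,5)] ql_le_iff[OF c(2,5)] assms(3,5,6) by blast+
  then have "ql_le G P s (a \<otimes> b)" "ql_le G P s' (a \<otimes> b)"
    using ql_le_trans[OF c(3,1,5) s(2)] ql_le_trans[OF c(4,2,5) s'(2)] by blast+
  then have "ql_bounded G P s s'"
    using cone_mult_closed[OF assms(2,3)] unfolding ql_bounded_def ql_upper_bound_def by blast
  then have "s = s'"
    using assms(1) m s(1) s'(1) unfolding minimality_property_def by blast
  moreover have "\<forall>k\<in>K. m k \<le> \<theta> s k"
    using sS(1) in_upper_preimage[OF m, of s] by auto
  ultimately show ?thesis
    using s(2) s'(2) sP by blast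
qed

text \<open>
  This chooses the common lower bound \<open>s\<close> of two left parts \<open>a\<close>, \<open>a'\<close> of the same letter. The
  clauses on \<open>t\<close> and \<open>t'\<close> are what makes the choices at all letters fit together to a cut: where
  \<open>s\<close> falls short of \<open>a\<close>, the other cut is incomplete, so that its later left parts at vertices
  that are not adjacent, and with them their lower bounds, are trivial.
\<close>

lemma common_syllable:
  assumes "minimality_property G P K \<theta>"
    and "a \<in> P" "b \<in> P" "a' \<in> P" "b' \<in> P" "a \<otimes> b = a' \<otimes> b'"
    and "b \<noteq> \<one> \<Longrightarrow> \<forall>k\<in>K. m k \<le> \<theta> a k" "b' \<noteq> \<one> \<Longrightarrow> \<forall>k\<in>K. m k \<le> \<theta> a' k"
  shows "\<exists>s\<in>P. \<exists>t\<in>P. \<exists>t'\<in>P. s \<otimes> t = a \<and> s \<otimes> t' = a' \<and> (t = \<one> \<or> b' \<noteq> \<one>) \<and> (t' = \<one> \<or> b \<noteq> \<one>) \<and>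
    (b \<noteq> \<one> \<or> b' \<noteq> \<one> \<longrightarrow> (\<forall>k\<in>K. m k \<le> \<theta> s k))"
proof -
  note c = assms(2-5)[THEN cone_carrier]
  consider "b = \<one>" "b' = \<one>" | "b = \<one>" "b' \<noteq> \<one>" | "b \<noteq> \<one>" "b' = \<one>" | "b \<noteq> \<one>" "b' \<noteq> \<one>"
    by blast
  then show ?thesis
  proof cases
    case 1
    then show ?thesis
      using assms c cone_one by (intro bexI[of _ a] bexI[of _ \<one>]) auto
  next
    case 2
    then show ?thesis
      using assms c cone_one by (intro bexI[of _ a'] bexI[of _ b'] bexI[of _ \<one>]) auto
  next
    case 3
    then show ?thesis
      using assms c cone_one by (intro bexI[of _ a] bexI[of _ b] bexI[of _ \<one>]) auto
  next
    case 4
    then obtain s where "s \<in> P" "ql_le G P s a" "ql_le G P s a'" "\<forall>k\<in>K. m k \<le> \<theta> s k"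
      using common_lower_bound[OF assms(1-6), of m] assms(7,8) by blast
    moreover from this obtain t t' where "t \<in> P" "a = s \<otimes> t" "t' \<in> P" "a' = s \<otimes> t'"
      using ql_le_iff[OF cone_carrier c(1), of s] ql_le_iff[OF cone_carrier c(3), of s] by blast
    ultimately show ?thesis
      using 4 by blast
  qed
qed

end

section \<open>Cutting positive words\<close>

locale graph_of_quasi_lattices = graph_of_groups V E G
  for V :: "'v set" and E :: "('v \<times> 'v) set" and G :: "'v \<Rightarrow> ('a, 'b) monoid_scheme" +
  fixes P :: "'v \<Rightarrow> 'a set"
  assumes quasi_lattice: "\<And>I. I \<in> V \<Longrightarrow> quasi_lattice_ordered (G I) (P I)"
begin

definition pos_words :: "('v \<times> 'a) list set" where
  "pos_words = lists (SIGMA I:V. P I)"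

lemma pos_words_simps:
  "[] \<in> pos_words" "(I, g) # w \<in> pos_words \<longleftrightarrow> I \<in> V \<and> g \<in> P I \<and> w \<in> pos_words"
  "u @ v \<in> pos_words \<longleftrightarrow> u \<in> pos_words \<and> v \<in> pos_words"
  by (auto simp: pos_words_def)

lemma cone_in_carrier: "I \<in> V \<Longrightarrow> g \<in> P I \<Longrightarrow> g \<in> carrier (G I)"
  using quasi_lattice quasi_lattice_ordered.cone_carrier by metis

lemma pos_gp_words: "w \<in> pos_words \<Longrightarrow> w \<in> gp_words V G"
  using cone_in_carrier by (auto simp: pos_words_def gp_words_def)

text \<open>
  A triple \<open>(I, a, b)\<close> stands for the letter \<open>(I, a b)\<close> cut into a left part \<open>a\<close> and a right
  part \<open>b\<close>. The word that is cut, its left parts and its right parts are \<open>outer\<close>, \<open>lower\<close> and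
  \<open>upper\<close>.
\<close>

definition outer :: "('v \<times> 'a \<times> 'a) list \<Rightarrow> ('v \<times> 'a) list" where
  "outer c = map (\<lambda>(I, a, b). (I, a \<otimes>\<^bsub>G I\<^esub> b)) c"

definition lower :: "('v \<times> 'a \<times> 'a) list \<Rightarrow> ('v \<times> 'a) list" where
  "lower c = map (\<lambda>(I, a, b). (I, a)) c"

definition upper :: "('v \<times> 'a \<times> 'a) list \<Rightarrow> ('v \<times> 'a) list" where
  "upper c = map (\<lambda>(I, a, b). (I, b)) c"

text \<open>
  The right part of the first letter can move past the left part of the second.
\<close>

definition compatible :: "'v \<times> 'a \<times> 'a \<Rightarrow> 'v \<times> 'a \<times> 'a \<Rightarrow> bool" where
  "compatible = (\<lambda>(I, a, b) (J, a', b'). (I, J) \<in> E \<or> b = \<one>\<^bsub>G I\<^esub> \<or> a' = \<one>\<^bsub>G J\<^esub>)"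

lemma compatible_simp:
  "compatible (I, a, b) (J, a', b') \<longleftrightarrow> (I, J) \<in> E \<or> b = \<one>\<^bsub>G I\<^esub> \<or> a' = \<one>\<^bsub>G J\<^esub>"
  by (simp add: compatible_def)

definition cut :: "('v \<times> 'a \<times> 'a) list \<Rightarrow> bool" where
  "cut c \<longleftrightarrow> (\<forall>(I, a, b)\<in>set c. I \<in> V \<and> a \<in> P I \<and> b \<in> P I) \<and>
     sorted_wrt compatible c"

lemma cut_words: "cut c \<Longrightarrow> lower c \<in> pos_words \<and> upper c \<in> pos_words"
  by (auto simp: cut_def lower_def upper_def pos_words_def)

lemma cut_Cons:
  "cut ((I, a, b) # c) \<longleftrightarrow> I \<in> V \<and> a \<in> P I \<and> b \<in> P I \<and> cut c \<and>
    (b = \<one>\<^bsub>G I\<^esub> \<or> (\<forall>(J, g)\<in>set (lower c). (I, J) \<in> E \<or> g = \<one>\<^bsub>G J\<^esub>))"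
  unfolding cut_def lower_def compatible_def by fastforce

lemma outer_append: "outer (c @ d) = outer c @ outer d"
  and lower_append: "lower (c @ d) = lower c @ lower d"
  by (auto simp: outer_def lower_def)

lemma outer_split:
  assumes "outer c = u @ v"
  shows "\<exists>c1 c2. c = c1 @ c2 \<and> outer c1 = u \<and> outer c2 = v"
  using assms unfolding outer_def by (auto simp: map_eq_append_conv)

lemma outer_Cons_iff:
  "outer c = (I, g) # v \<longleftrightarrow> (\<exists>a b c'. c = (I, a, b) # c' \<and> g = a \<otimes>\<^bsub>G I\<^esub> b \<and> outer c' = v)"
  unfolding outer_def by (cases c) auto

text \<open>
  When two letters of a vertex are merged, compatibility says that the first right part or the
  second left part is trivial, because a vertex is not adjacent to itself; so the left parts and
  the right parts can be multiplied separately. When a unit is deleted, both its parts are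
  units.
\<close>

lemma cut_reduces:
  assumes "gp_reduces u v" "cut c" "outer c = u"
  shows "\<exists>c'. cut c' \<and> outer c' = v \<and> gp_eq V E G (lower c) (lower c')"
  using assms
proof (induction arbitrary: c rule: gp_reduces.induct)
  case (reduces_refl w)
  then show ?case
    using gp_refl cut_words pos_gp_words by blast
next
  case (reduces_trans u v w)
  obtain c' where c': "cut c'" "outer c' = v" "gp_eq V E G (lower c) (lower c')"
    using reduces_trans.IH(1)[OF reduces_trans.prems] by blast
  then obtain c'' where "cut c''" "outer c'' = w" "gp_eq V E G (lower c') (lower c'')"
    using reduces_trans.IH(2)[OF c'(1,2)] by blast
  with gp_trans[OF c'(3)] show ?case
    by blast
next
  case (reduces_unit u I v)
  then obtain c1 a b c2 where c: "c = c1 @ (I, a, b) # c2" "outer c1 = u" "outer c2 = v"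
      "a \<otimes>\<^bsub>G I\<^esub> b = \<one>\<^bsub>G I\<^esub>"
    using outer_split[of c u] by (fastforce simp: outer_Cons_iff)
  with reduces_unit have I: "I \<in> V" "a \<in> P I" "b \<in> P I"
    by (auto simp: cut_def)
  then interpret quasi_lattice_ordered "G I" "P I" using quasi_lattice by blast
  have a: "a = \<one>\<^bsub>G I\<^esub>"
    using cone_mult_eq_one c I by blast
  have w: "lower c1 \<in> gp_words V G" "lower c2 \<in> gp_words V G"
    using cut_words[OF reduces_unit(1)] pos_gp_words c
    by (auto simp: lower_append lower_def pos_words_simps)
  have "cut (c1 @ c2)"
    using reduces_unit(1) c by (auto simp: cut_def sorted_wrt_append compatible_simp)
  moreover have "gp_eq V E G (lower c) (lower (c1 @ c2))"
    using gp_unit[OF w I(1)] c a by (simp add: lower_append lower_def)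
  ultimately show ?case
    using c by (auto simp: outer_append)
next
  case (reduces_mult u I g h v)
  then obtain c1 a b a' b' c2 where c: "c = c1 @ (I, a, b) # (I, a', b') # c2"
      "outer c1 = u" "outer c2 = v" "g = a \<otimes>\<^bsub>G I\<^esub> b" "h = a' \<otimes>\<^bsub>G I\<^esub> b'"
    using outer_split[of c u] by (fastforce simp: outer_Cons_iff)
  with reduces_mult have I: "I \<in> V" "a \<in> P I" "b \<in> P I" "a' \<in> P I" "b' \<in> P I"
    by (auto simp: cut_def)
  then interpret quasi_lattice_ordered "G I" "P I" using quasi_lattice by blast
  have w: "lower c1 \<in> gp_words V G" "lower c2 \<in> gp_words V G"
    using cut_words[OF reduces_mult(1)] pos_gp_words c
    by (auto simp: lower_append lower_def pos_words_simps)
  have "(I, I) \<notin> E"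
    using irreflE by (simp add: irrefl_def)
  then have or: "b = \<one>\<^bsub>G I\<^esub> \<or> a' = \<one>\<^bsub>G I\<^esub>"
    using reduces_mult(1) c by (auto simp: cut_def sorted_wrt_append compatible_simp)
  let ?c = "c1 @ (I, a \<otimes>\<^bsub>G I\<^esub> a', b \<otimes>\<^bsub>G I\<^esub> b') # c2"
  note Ic = I(2-5)[THEN cone_carrier]
  have "a \<otimes>\<^bsub>G I\<^esub> a' \<otimes>\<^bsub>G I\<^esub> (b \<otimes>\<^bsub>G I\<^esub> b') = g \<otimes>\<^bsub>G I\<^esub> h"
  proof -
    have "a \<otimes>\<^bsub>G I\<^esub> a' \<otimes>\<^bsub>G I\<^esub> (b \<otimes>\<^bsub>G I\<^esub> b') = a \<otimes>\<^bsub>G I\<^esub> b \<otimes>\<^bsub>G I\<^esub> (a' \<otimes>\<^bsub>G I\<^esub> b')"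
      using or
    proof
      assume "b = \<one>\<^bsub>G I\<^esub>"
      then show ?thesis using Ic by (simp add: m_assoc)
    next
      assume "a' = \<one>\<^bsub>G I\<^esub>"
      then show ?thesis using Ic by (simp add: m_assoc)
    qed
    with c show ?thesis by simp
  qed
  then have "outer ?c = u @ [(I, g \<otimes>\<^bsub>G I\<^esub> h)] @ v"
    using c by (simp add: outer_def)
  moreover have "cut ?c"
  proof -
    let ?x = "(I, a \<otimes>\<^bsub>G I\<^esub> a', b \<otimes>\<^bsub>G I\<^esub> b')"
    have old: "sorted_wrt compatible (c1 @ (I, a, b) # (I, a', b') # c2)"
      using reduces_mult(1) c by (simp add: cut_def)
    have "compatible x ?x" if "x \<in> set c1" for x
    proof -
      have "compatible x (I, a, b)" "compatible x (I, a', b')"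
        using old that by (simp_all add: sorted_wrt_append)
      then show ?thesis
        using Ic by (cases x) (auto simp: compatible_simp)
    qed
    moreover have "compatible ?x y" if "y \<in> set c2" for y
    proof -
      have "compatible (I, a, b) y" "compatible (I, a', b') y"
        using old that by (simp_all add: sorted_wrt_append)
      then show ?thesis
        using Ic by (cases y) (auto simp: compatible_simp)
    qed
    ultimately have "sorted_wrt compatible ?c"
      using old by (simp add: sorted_wrt_append)
    then show ?thesis
      using reduces_mult(1) c I cone_mult_closed unfolding cut_def by simp
  qed
  moreover have "gp_eq V E G (lower c) (lower ?c)"
    using gp_mult[OF w I(1), of a a'] Ic c by (simp add: lower_append lower_def)
  ultimately show ?case
    by blast
next
  case (reduces_comm I J u g h v)
  then obtain c1 a b a' b' c2 where c: "c = c1 @ (I, a, b) # (J, a', b') # c2"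
      "outer c1 = u" "outer c2 = v" "g = a \<otimes>\<^bsub>G I\<^esub> b" "h = a' \<otimes>\<^bsub>G J\<^esub> b'"
    using outer_split[of c u] by (fastforce simp: outer_Cons_iff)
  with reduces_comm have I: "I \<in> V" "J \<in> V" "a \<in> P I" "a' \<in> P J"
    by (auto simp: cut_def)
  have w: "lower c1 \<in> gp_words V G" "lower c2 \<in> gp_words V G"
    using cut_words[OF reduces_comm(2)] pos_gp_words c
    by (auto simp: lower_append lower_def pos_words_simps)
  let ?c = "c1 @ (J, a', b') # (I, a, b) # c2"
  have "(J, I) \<in> E"
    using reduces_comm symE by (meson symD)
  then have "cut ?c"
    using reduces_comm c by (auto simp: cut_def sorted_wrt_append compatible_simp)
  moreover have "gp_eq V E G (lower c) (lower ?c)"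
    using gp_comm[OF w I(1,2) reduces_comm(1), of a a'] I cone_in_carrier c
    by (simp add: lower_append lower_def)
  moreover have "outer ?c = u @ [(J, h), (I, g)] @ v"
    using c by (simp add: outer_def)
  ultimately show ?case
    by blast
qed

lemma commute_past:
  assumes "I \<in> V" "b \<in> P I" "w \<in> pos_words" "b = \<one>\<^bsub>G I\<^esub> \<or> (\<forall>(J, g)\<in>set w. (I, J) \<in> E \<or> g = \<one>\<^bsub>G J\<^esub>)"
  shows "gp_eq V E G ((I, b) # w) (w @ [(I, b)])"
  using assms(3,4)
proof (induction w)
  case Nil
  then show ?case
    using assms cone_in_carrier by (auto intro!: gp_refl simp: gp_words_simps)
next
  case (Cons x w)
  obtain J g where x: "x = (J, g)" by (cases x)
  with Cons.prems have J: "J \<in> V" "g \<in> P J" "w \<in> pos_words" 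
    by (auto simp: pos_words_simps)
  have wd: "w \<in> gp_words V G" "b \<in> carrier (G I)" "g \<in> carrier (G J)" "[(I, b)] \<in> gp_words V G"
      "[(J, g)] \<in> gp_words V G"
    using J assms cone_in_carrier pos_gp_words by (auto simp: gp_words_simps)
  interpret I: group "G I" using groups assms by blast
  interpret J: group "G J" using groups J by blast
  have "gp_eq V E G ([(I, b), (J, g)] @ w) ([(J, g), (I, b)] @ w)"
  proof -
    consider "b = \<one>\<^bsub>G I\<^esub>" | "(I, J) \<in> E" | "g = \<one>\<^bsub>G J\<^esub>"
      using Cons.prems x by auto
    then show ?thesis
    proof cases
      case 1
      have "gp_eq V E G ([(I, b), (J, g)] @ w) ([(J, g)] @ w)"
        "gp_eq V E G ([(J, g), (I, b)] @ w) ([(J, g)] @ w)"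
        using gp_unit[of "[]" V G "(J, g) # w" I E] gp_unit[of "[(J, g)]" V G w I E] 1 assms J wd
        by (auto simp: gp_words_simps)
      then show ?thesis using gp_sym gp_trans by blast
    next
      case 2
      then show ?thesis
        using gp_comm[of "[]" V G w I J E b g] assms J wd by (auto simp: gp_words_simps)
    next
      case 3
      have "gp_eq V E G ([(I, b), (J, g)] @ w) ([(I, b)] @ w)"
        "gp_eq V E G ([(J, g), (I, b)] @ w) ([(I, b)] @ w)"
        using gp_unit[of "[]" V G "(I, b) # w" J E] gp_unit[of "[(I, b)]" V G w J E] 3 assms J wd
        by (auto simp: gp_words_simps)
      then show ?thesis using gp_sym gp_trans by blast
    qed
  qed
  moreover have "gp_eq V E G ([(J, g)] @ (I, b) # w) ([(J, g)] @ w @ [(I, b)])"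
    using Cons x J by (intro gp_eq_append[OF gp_refl[OF wd(5)]]) auto
  ultimately show ?case
    using gp_trans x by auto
qed

text \<open>
  The right part of the first letter moves past all later left parts, and the remaining letters
  are handled by induction.
\<close>

lemma cut_product: "cut c \<Longrightarrow> gp_eq V E G (outer c) (lower c @ upper c)"
proof (induction c)
  case Nil
  then show ?case by (auto simp: outer_def lower_def upper_def gp_words_simps intro: gp_refl)
next
  case (Cons x c)
  obtain I a b where x: "x = (I, a, b)" by (cases x)
  with Cons.prems have I: "I \<in> V" "a \<in> P I" "b \<in> P I" "cut c"
      "b = \<one>\<^bsub>G I\<^esub> \<or> (\<forall>(J, g)\<in>set (lower c). (I, J) \<in> E \<or> g = \<one>\<^bsub>G J\<^esub>)"
    by (auto simp: cut_Cons)
  then have w: "lower c \<in> pos_words" "upper c \<in> pos_words" "lower c \<in> gp_words V G" "upper c \<in> gp_words V G"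
      "a \<in> carrier (G I)" "b \<in> carrier (G I)"
    using cut_words pos_gp_words cone_in_carrier by auto
  have ec: "outer c \<in> gp_words V G"
    using gp_eq_words Cons.IH I by blast
  have "gp_eq V E G ((I, a \<otimes>\<^bsub>G I\<^esub> b) # outer c) ([(I, a), (I, b)] @ outer c)"
    using gp_sym[OF gp_mult[of "[]" V G "outer c" I a b E]] I w ec by (simp add: gp_words_simps)
  moreover have "gp_eq V E G ([(I, a), (I, b)] @ outer c) ([(I, a), (I, b)] @ lower c @ upper c)"
    using Cons.IH I w by (intro gp_eq_append[OF gp_refl]) (auto simp: gp_words_simps)
  moreover have "gp_eq V E G ([(I, a)] @ ((I, b) # lower c) @ upper c) ([(I, a)] @ (lower c @ [(I, b)]) @ upper c)"
    using commute_past[OF I(1,3) w(1) I(5)] I w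
    by (intro gp_eq_append[OF gp_refl] gp_eq_append[OF _ gp_refl]) (auto simp: gp_words_simps)
  ultimately show ?case
    unfolding x by (auto simp: outer_def lower_def upper_def intro: gp_trans)
qed

text \<open>
  The letters of \<open>u\<close> are cut at their right end and those of \<open>v\<close> at their left end.
\<close>

lemma ex_cut_of_product:
  assumes "u \<in> pos_words" "v \<in> pos_words"
  shows "\<exists>c. cut c \<and> outer c = u @ v \<and> gp_eq V E G (lower c) u"
proof -
  define c1 where "c1 = map (\<lambda>(I, g). (I, g, \<one>\<^bsub>G I\<^esub>)) u"
  define c2 where "c2 = map (\<lambda>(I, g). (I, \<one>\<^bsub>G I\<^esub>, g)) v"
  have one: "\<one>\<^bsub>G I\<^esub> \<in> P I" if "I \<in> V" for I
    using quasi_lattice quasi_lattice_ordered.cone_one that by blast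
  have rone: "g \<otimes>\<^bsub>G I\<^esub> \<one>\<^bsub>G I\<^esub> = g" "\<one>\<^bsub>G I\<^esub> \<otimes>\<^bsub>G I\<^esub> g = g" if "I \<in> V" "g \<in> P I" for I g
    using groups that cone_in_carrier by (auto simp: group.is_monoid monoid.r_one monoid.l_one)
  have "outer c1 = u"
    using assms(1) unfolding c1_def
    by (induction u) (auto simp: outer_def pos_words_simps rone)
  moreover have "outer c2 = v"
    using assms(2) unfolding c2_def
    by (induction v) (auto simp: outer_def pos_words_simps rone)
  moreover have "lower c1 = u"
    unfolding c1_def by (induction u) (auto simp: lower_def)
  moreover have "gp_eq V E G (u @ lower c2) u"
    using assms(2) unfolding c2_def
  proof (induction v)
    case Nil
    then show ?case using assms pos_gp_words by (auto simp: lower_def intro: gp_refl)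
  next
    case (Cons x v)
    obtain J g where x: "x = (J, g)" by (cases x)
    have J: "J \<in> V" "v \<in> pos_words"
      using Cons.prems x by (auto simp: pos_words_simps)
    have "lower (map (\<lambda>(I, g). (I, \<one>\<^bsub>G I\<^esub>, g)) v) \<in> gp_words V G"
      using J by (intro pos_gp_words) (fastforce simp: lower_def pos_words_def intro: one)
    then show ?case
      using gp_trans[OF gp_unit Cons.IH] assms pos_gp_words J x by (simp add: lower_def)
  qed
  moreover have "sorted_wrt compatible c1"
    unfolding c1_def by (induction u) (auto simp: compatible_simp)
  moreover have "sorted_wrt compatible c2"
    unfolding c2_def by (induction v) (auto simp: compatible_simp)
  then have "cut (c1 @ c2)"
    using assms one calculation unfolding cut_def sorted_wrt_append
    by (auto simp: c1_def c2_def pos_words_def compatible_simp)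
  ultimately show ?thesis
    by (intro exI[of _ "c1 @ c2"]) (simp add: outer_append lower_append)
qed

end

section \<open>The minimality property of the completion map\<close>

locale graph_of_controlled_maps = graph_of_quasi_lattices V E G P
  for V :: "'v set" and E :: "('v \<times> 'v) set" and G :: "'v \<Rightarrow> ('a, 'b) monoid_scheme"
    and P :: "'v \<Rightarrow> 'a set" +
  fixes N :: "'v \<Rightarrow> nat" and \<theta> :: "'v \<Rightarrow> 'a \<Rightarrow> nat \<Rightarrow> int"
  assumes controlled_maps: "\<And>I. I \<in> V \<Longrightarrow> controlled_map (G I) (P I) {..<N I} (\<theta> I)"
begin

lemma vertex: "I \<in> V \<Longrightarrow> controlled_quasi_lattice (G I) (P I) {..<N I} (\<theta> I)"
  unfolding controlled_quasi_lattice_def controlled_quasi_lattice_axioms_def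
  using quasi_lattice controlled_maps by blast

text \<open>
  The coordinates of the completion map on the element that \<open>w\<close> represents; see
  \<open>completion_map_word\<close>.
\<close>

definition weight :: "('v \<times> 'a) list \<Rightarrow> 'v \<Rightarrow> nat \<Rightarrow> int" where
  "weight w J k = (\<Sum>(I, g)\<leftarrow>w. if J = I then \<theta> I g k else 0)"

lemma weight_simps:
  "weight [] J k = 0"
  "weight ((I, g) # w) J k = (if J = I then \<theta> I g k else 0) + weight w J k"
  by (auto simp: weight_def)

lemma weight_nonneg: "w \<in> pos_words \<Longrightarrow> k < N J \<Longrightarrow> 0 \<le> weight w J k"
proof (induction w)
  case Nil
  then show ?case by (simp add: weight_simps)
next
  case (Cons x w)
  obtain I g where x: "x = (I, g)" by (cases x)
  with Cons.prems have I: "I \<in> V" "g \<in> P I" "w \<in> pos_words"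
    by (auto simp: pos_words_simps)
  then interpret controlled_quasi_lattice "G I" "P I" "{..<N I}" "\<theta> I" using vertex by blast
  show ?case
    using Cons I theta_nonneg[of g k] x by (auto simp: weight_simps)
qed

text \<open>
  When \<open>E\<close> is irreflexive, as here, this also covers the letters of \<open>I\<close> itself.
\<close>

definition trivial_beyond :: "'v \<Rightarrow> ('v \<times> 'a) list \<Rightarrow> bool" where
  "trivial_beyond I w \<longleftrightarrow> (\<forall>(J, g)\<in>set w. (I, J) \<in> E \<or> g = \<one>\<^bsub>G J\<^esub>)"

lemma weight_zero: 
  assumes "I \<in> V" "trivial_beyond I w" "k < N I"
  shows "weight w I k = 0"
proof -
  interpret controlled_quasi_lattice "G I" "P I" "{..<N I}" "\<theta> I" using vertex assms by blast
  have "(I, I) \<notin> E"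
    using irreflE by (simp add: irrefl_def)
  with assms(2) show ?thesis
  proof (induction w)
    case Nil
    then show ?case by (simp add: weight_simps)
  next
    case (Cons x w)
    then show ?case
      using theta_one[of k] assms(3) by (cases x) (auto simp: trivial_beyond_def weight_simps)
  qed
qed

lemma trivial_beyond_lower:
  assumes "cut e" "trivial_beyond I (outer e)"
  shows "trivial_beyond I (lower e)"
proof -
  have "g = \<one>\<^bsub>G J\<^esub>" if "(J, g, h) \<in> set e" "(I, J) \<notin> E" for J g h
  proof -
    have J: "J \<in> V" "g \<in> P J" "h \<in> P J"
      using assms(1) that by (auto simp: cut_def)
    then interpret quasi_lattice_ordered "G J" "P J" using quasi_lattice by blast
    have "g \<otimes>\<^bsub>G J\<^esub> h = \<one>\<^bsub>G J\<^esub>"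
      using assms(2) that unfolding trivial_beyond_def outer_def by fastforce
    then show ?thesis
      using cone_mult_eq_one J by blast
  qed
  then show ?thesis
    unfolding trivial_beyond_def lower_def by fastforce
qed

text \<open>
  The requirement \<open>M\<close> is variable in the induction: after the first letter only what its lower
  bound \<open>s\<close> has not yet contributed remains to be met by the other letters. If one of the cuts
  is incomplete at the first letter, then \<open>s\<close> already meets the whole requirement at that
  vertex, and what remains is nonpositive.
\<close>

lemma common_lower_cut:
  assumes min: "\<And>I. I \<in> V \<Longrightarrow> minimality_property (G I) (P I) {..<N I} (\<theta> I)"
    and "cut c" "cut c'" "outer c = outer c'"
    and "\<forall>J\<in>V. \<forall>k<N J. M J k \<le> weight (lower c) J k"
    and "\<forall>J\<in>V. \<forall>k<N J. M J k \<le> weight (lower c') J k"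
  shows "\<exists>e e'. cut e \<and> cut e' \<and> lower e = lower e' \<and> outer e = lower c \<and> outer e' = lower c' \<and>
    (\<forall>J\<in>V. \<forall>k<N J. M J k \<le> weight (lower e) J k)"
  using assms(2-)
proof (induction c arbitrary: c' M)
  case Nil
  then show ?case
    by (intro exI[of _ "[]"]) (auto simp: outer_def lower_def)
next
  case (Cons x c)
  obtain I a b where x: "x = (I, a, b)" by (cases x)
  have "outer c' = (I, a \<otimes>\<^bsub>G I\<^esub> b) # outer c"
    using Cons.prems(3) x by (simp add: outer_def)
  then obtain a' b' d where c': "c' = (I, a', b') # d" "a \<otimes>\<^bsub>G I\<^esub> b = a' \<otimes>\<^bsub>G I\<^esub> b'" "outer d = outer c"
    unfolding outer_Cons_iff by blast
  have cc: "I \<in> V" "a \<in> P I" "b \<in> P I" "cut c" "b = \<one>\<^bsub>G I\<^esub> \<or> trivial_beyond I (lower c)"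
    using Cons.prems(1) cut_Cons[of I a b c] x unfolding trivial_beyond_def by blast+
  have cd: "a' \<in> P I" "b' \<in> P I" "cut d" "b' = \<one>\<^bsub>G I\<^esub> \<or> trivial_beyond I (lower d)"
    using Cons.prems(2) cut_Cons[of I a' b' d] c' unfolding trivial_beyond_def by blast+
  interpret controlled_quasi_lattice "G I" "P I" "{..<N I}" "\<theta> I" using vertex cc by blast
  have lower: "lower (x # c) = (I, a) # lower c" "lower c' = (I, a') # lower d"
    using x c' by (auto simp: lower_def)
  have M: "M J k \<le> (if J = I then \<theta> I a k else 0) + weight (lower c) J k"
     "M J k \<le> (if J = I then \<theta> I a' k else 0) + weight (lower d) J k" if "J \<in> V" "k < N J" for J k
    using Cons.prems(4,5) that unfolding lower weight_simps by blast+
  \<comment> \<open>a cut that is incomplete at this letter has no further contribution at the vertex \<open>I\<close>\<close>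
  have "\<forall>k\<in>{..<N I}. M I k \<le> \<theta> I a k" if "b \<noteq> \<one>\<^bsub>G I\<^esub>"
    using M(1)[of I] weight_zero[of I "lower c"] cc that by auto
  moreover have "\<forall>k\<in>{..<N I}. M I k \<le> \<theta> I a' k" if "b' \<noteq> \<one>\<^bsub>G I\<^esub>"
    using M(2)[of I] weight_zero[of I "lower d"] cc cd that by auto
  ultimately obtain s t t' where s: "s \<in> P I" "t \<in> P I" "t' \<in> P I"
      "s \<otimes>\<^bsub>G I\<^esub> t = a" "s \<otimes>\<^bsub>G I\<^esub> t' = a'" "t = \<one>\<^bsub>G I\<^esub> \<or> b' \<noteq> \<one>\<^bsub>G I\<^esub>" "t' = \<one>\<^bsub>G I\<^esub> \<or> b \<noteq> \<one>\<^bsub>G I\<^esub>"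
      "b \<noteq> \<one>\<^bsub>G I\<^esub> \<or> b' \<noteq> \<one>\<^bsub>G I\<^esub> \<longrightarrow> (\<forall>k\<in>{..<N I}. M I k \<le> \<theta> I s k)"
    using common_syllable[OF min[OF cc(1)] cc(2,3) cd(1,2) c'(2), of "M I"] by blast
  \<comment> \<open>the requirement that is left for the letters after the first\<close>
  define M' where "M' J k = M J k - (if J = I then \<theta> I s k else 0)" for J k
  have rest: "M' I k \<le> weight (lower c) I k" "M' I k \<le> weight (lower d) I k" if "k < N I" for k
  proof -
    have "M' I k \<le> weight (lower c) I k \<and> M' I k \<le> weight (lower d) I k"
    proof (cases "b = \<one>\<^bsub>G I\<^esub> \<and> b' = \<one>\<^bsub>G I\<^esub>")
      case True
      then have "s = a" "s = a'"
        using s cone_carrier by auto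
      then show ?thesis
        using M[of I k] cc that by (auto simp: M'_def)
    next
      case False
      then have "M' I k \<le> 0"
        using s(8) that by (auto simp: M'_def)
      moreover have "0 \<le> weight (lower c) I k" "0 \<le> weight (lower d) I k"
        using weight_nonneg cut_words cc cd that by blast+
      ultimately show ?thesis by linarith
    qed
    then show "M' I k \<le> weight (lower c) I k" "M' I k \<le> weight (lower d) I k" by blast+
  qed
  have "\<forall>J\<in>V. \<forall>k<N J. M' J k \<le> weight (lower c) J k" "\<forall>J\<in>V. \<forall>k<N J. M' J k \<le> weight (lower d) J k"
  proof (safe)
    fix J k assume J: "J \<in> V" "k < N J"
    show "M' J k \<le> weight (lower c) J k"
      using rest(1)[of k] M(1)[OF J] J by (cases "J = I") (auto simp: M'_def)
    show "M' J k \<le> weight (lower d) J k"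
      using rest(2)[of k] M(2)[OF J] J by (cases "J = I") (auto simp: M'_def)
  qed
  then obtain e e' where e: "cut e" "cut e'" "lower e = lower e'" "outer e = lower c" "outer e' = lower d"
      "\<forall>J\<in>V. \<forall>k<N J. M' J k \<le> weight (lower e) J k"
    using Cons.IH[OF cc(4) cd(3) c'(3)[symmetric], of M'] by blast
  have "t = \<one>\<^bsub>G I\<^esub> \<or> trivial_beyond I (lower e)"
    using s(6) cd(4) trivial_beyond_lower[OF e(2), of I] e(3,5) by auto
  then have "cut ((I, s, t) # e)"
    using cc s e unfolding cut_Cons trivial_beyond_def by blast
  moreover have "t' = \<one>\<^bsub>G I\<^esub> \<or> trivial_beyond I (lower e')"
    using s(7) cc(5) trivial_beyond_lower[OF e(1), of I] e(3,4) by auto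
  then have "cut ((I, s, t') # e')"
    using cc s e unfolding cut_Cons trivial_beyond_def by blast
  moreover have "lower ((I, s, t) # e) = (I, s) # lower e" "lower ((I, s, t') # e') = (I, s) # lower e"
      "outer ((I, s, t) # e) = lower (x # c)" "outer ((I, s, t') # e') = lower c'"
    using e s x c' by (auto simp: lower_def outer_def)
  moreover have "\<forall>J\<in>V. \<forall>k<N J. M J k \<le> weight ((I, s) # lower e) J k"
    using e(6) by (auto simp: M'_def weight_simps algebra_simps)
  ultimately show ?case
    by metis
qed

lemma completion_map_word:
  assumes "completion_map V E G N \<theta> \<Theta>" "w \<in> gp_words V G" "J \<in> V" "k < N J"
  shows "\<Theta> (gp_class w) (J, k) = weight w J k"
  using assms(2)
proof (induction w)
  case Nil
  interpret L: group "int_lattice (SIGMA I:V. {..<N I})" by (rule group_int_lattice)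
  interpret GP: group "graph_product V E G" by (rule group_graph_product)
  have "\<Theta> (gp_class []) = \<one>\<^bsub>int_lattice (SIGMA I:V. {..<N I})\<^esub>"
    using assms(1) hom_one[OF _ GP.is_group L.is_group] unfolding completion_map_def one_graph_product[symmetric]
    by blast
  then show ?case
    using assms by (simp add: weight_simps int_lattice_def)
next
  case (Cons x w)
  obtain I g where x: "x = (I, g)" by (cases x)
  with Cons.prems have I: "I \<in> V" "g \<in> carrier (G I)" "w \<in> gp_words V G"
    by (auto simp: gp_words_simps)
  have c: "gp_incl V E G I g \<in> carrier (graph_product V E G)" "gp_class w \<in> carrier (graph_product V E G)"
    using I by (auto simp: gp_incl_def carrier_graph_product gp_words_simps)
  have "gp_class (x # w) = gp_incl V E G I g \<otimes>\<^bsub>graph_product V E G\<^esub> gp_class w"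
    using I x by (simp add: gp_incl_def mult_graph_product gp_words_simps)
  then have "\<Theta> (gp_class (x # w)) =
      lattice_incl V N I (\<theta> I g) \<otimes>\<^bsub>int_lattice (SIGMA I:V. {..<N I})\<^esub> \<Theta> (gp_class w)"
    using assms(1) I hom_mult[OF _ c, of \<Theta> "int_lattice (SIGMA I:V. {..<N I})"]
    unfolding completion_map_def by metis
  then show ?case
    using Cons.IH I assms(3,4) x by (simp add: mult_int_lattice lattice_incl_def weight_simps)
qed

lemma cone_words: "A \<in> graph_product_cone V E G P \<Longrightarrow> \<exists>w\<in>pos_words. A = gp_class w"
  unfolding graph_product_cone_def
proof (induction rule: subsemigroup_generated.induct)
  case (incl s)
  then obtain I g where "I \<in> V" "g \<in> P I" "s = gp_class [(I, g)]"
    by (auto simp: gp_incl_def)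
  then show ?case
    by (intro bexI[of _ "[(I, g)]"]) (auto simp: pos_words_simps)
next
  case (mult s t)
  then obtain u v where "u \<in> pos_words" "v \<in> pos_words" "s = gp_class u" "t = gp_class v"
    by blast
  then show ?case
    by (intro bexI[of _ "u @ v"]) (auto simp: mult_graph_product pos_gp_words pos_words_simps)
qed

text \<open>
  The vertex \<open>I\<close> ensures that the generated subsemigroup contains the unit.
\<close>

lemma words_cone: 
  assumes "I \<in> V" "w \<in> pos_words"
  shows "gp_class w \<in> graph_product_cone V E G P"
  using assms(2)
proof (induction w)
  case Nil
  interpret quasi_lattice_ordered "G I" "P I" using quasi_lattice assms by blast
  have "gp_class [] = gp_incl V E G I \<one>\<^bsub>G I\<^esub>"
    using gp_class_eq[OF gp_unit[of "[]" V G "[]" I E]] assms by (simp add: gp_words_simps gp_incl_def)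
  then show ?case
    using assms cone_one unfolding graph_product_cone_def by (auto intro: subsemigroup_generated.incl)
next
  case (Cons x w)
  obtain J g where x: "x = (J, g)" by (cases x)
  with Cons.prems have J: "J \<in> V" "g \<in> P J" "w \<in> pos_words"
    by (auto simp: pos_words_simps)
  have "gp_class (x # w) = gp_incl V E G J g \<otimes>\<^bsub>graph_product V E G\<^esub> gp_class w"
    using J x cone_in_carrier pos_gp_words by (simp add: gp_incl_def mult_graph_product gp_words_simps)
  moreover have "gp_incl V E G J g \<in> graph_product_cone V E G P"
    using J unfolding graph_product_cone_def by (auto intro: subsemigroup_generated.incl)
  ultimately show ?case
    using Cons.IH J unfolding graph_product_cone_def by (auto intro: subsemigroup_generated.mult)
qed

lemma gp_eq_class: 
  assumes "u \<in> gp_words V G" "v \<in> gp_words V G" "gp_class u = gp_class v"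
  shows "gp_eq V E G u v"
  using assms eq_equiv_class[OF assms(3) equiv_gp_rel] by (simp add: gp_rel_def)

lemma ql_le_words:
  assumes "u \<in> pos_words" "v \<in> pos_words" "A = gp_class u" "B = gp_class (u @ v)" "I \<in> V"
  shows "ql_le (graph_product V E G) (graph_product_cone V E G P) A B"
proof -
  interpret GP: group "graph_product V E G" by (rule group_graph_product)
  have "gp_class u \<in> carrier (graph_product V E G)" "gp_class v \<in> carrier (graph_product V E G)"
    using assms pos_gp_words by (auto simp: carrier_graph_product)
  moreover have "B = gp_class u \<otimes>\<^bsub>graph_product V E G\<^esub> gp_class v"
    using assms pos_gp_words by (simp add: mult_graph_product)
  ultimately have "inv\<^bsub>graph_product V E G\<^esub> A \<otimes>\<^bsub>graph_product V E G\<^esub> B = gp_class v"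
    using assms(3) by (simp add: GP.m_assoc[symmetric])
  then show ?thesis
    using words_cone[OF assms(5,2)] by (simp add: ql_le_def)
qed

lemma ql_le_obtains_words:
  assumes "u \<in> pos_words" "B \<in> graph_product_cone V E G P"
    "ql_le (graph_product V E G) (graph_product_cone V E G P) (gp_class u) B"
  shows "\<exists>v\<in>pos_words. B = gp_class (u @ v)"
proof -
  interpret GP: group "graph_product V E G" by (rule group_graph_product)
  obtain w where w: "w \<in> pos_words" "B = gp_class w"
    using cone_words assms(2) by blast
  obtain v where v: "v \<in> pos_words" "inv\<^bsub>graph_product V E G\<^esub> (gp_class u) \<otimes>\<^bsub>graph_product V E G\<^esub> B = gp_class v"
    using cone_words assms(3) unfolding ql_le_def by blast
  have c: "gp_class u \<in> carrier (graph_product V E G)" "B \<in> carrier (graph_product V E G)"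
    using assms(1) w pos_gp_words by (auto simp: carrier_graph_product)
  then have "B = gp_class u \<otimes>\<^bsub>graph_product V E G\<^esub> gp_class v"
    unfolding v(2)[symmetric] by (simp add: GP.m_assoc[symmetric])
  then show ?thesis
    using v assms(1) pos_gp_words by (auto simp: mult_graph_product)
qed

text \<open>
  The cuts of a common word for \<open>p\<close> and \<open>q\<close> have a common lower cut whose left parts represent
  an element below \<open>p\<close> and \<open>q\<close> in the same upper preimage.
\<close>

lemma minimal_bounded_unique:
  assumes min: "\<And>I. I \<in> V \<Longrightarrow> minimality_property (G I) (P I) {..<N I} (\<theta> I)"
    and completion: "completion_map V E G N \<theta> \<Theta>"
    and m: "m \<in> int_cone (SIGMA I:V. {..<N I})"
    and p: "ql_minimal (graph_product V E G) (graph_product_cone V E G P)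
      (upper_preimage (graph_product_cone V E G P) (SIGMA I:V. {..<N I}) \<Theta> m) p"
    and q: "ql_minimal (graph_product V E G) (graph_product_cone V E G P)
      (upper_preimage (graph_product_cone V E G P) (SIGMA I:V. {..<N I}) \<Theta> m) q"
    and bounded: "ql_bounded (graph_product V E G) (graph_product_cone V E G P) p q"
  shows "p = q"
proof -
  let ?K = "SIGMA I:V. {..<N I}" and ?C = "graph_product_cone V E G P"
  let ?S = "upper_preimage ?C ?K \<Theta> m"
  have S: "gp_class w \<in> ?S \<longleftrightarrow> gp_class w \<in> ?C \<and> (\<forall>J\<in>V. \<forall>k<N J. m (J, k) \<le> weight w J k)"
    if "w \<in> pos_words" for w
  proof -
    have w: "w \<in> gp_words V G"
      using that pos_gp_words by blast
    then have "\<Theta> (gp_class w) \<in> carrier (int_lattice ?K)"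
      using completion hom_in_carrier[of \<Theta> "graph_product V E G" "int_lattice ?K" "gp_class w"]
      unfolding completion_map_def carrier_graph_product by blast
    then show ?thesis
      using m ql_le_int_lattice[of m ?K "\<Theta> (gp_class w)"] completion_map_word[OF completion w]
      by (auto simp: upper_preimage_def int_cone_def)
  qed
  have pq: "p \<in> ?S" "q \<in> ?S"
    using p q unfolding ql_minimal_def by blast+
  then have "p \<in> ?C" "q \<in> ?C"
    unfolding upper_preimage_def by blast+
  then obtain u v where u: "u \<in> pos_words" "p = gp_class u" and v: "v \<in> pos_words" "q = gp_class v"
    using cone_words by meson
  obtain r where r: "r \<in> ?C" "ql_le (graph_product V E G) ?C p r" "ql_le (graph_product V E G) ?C q r"
    using bounded unfolding ql_bounded_def ql_upper_bound_def by blast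
  obtain u' where u': "u' \<in> pos_words" "r = gp_class (u @ u')"
    using ql_le_obtains_words[OF u(1) r(1)] r(2) u(2) by blast
  obtain v' where v': "v' \<in> pos_words" "r = gp_class (v @ v')"
    using ql_le_obtains_words[OF v(1) r(1)] r(3) v(2) by blast
  have "gp_eq V E G (u @ u') (v @ v')"
    using u v u' v' pos_gp_words by (intro gp_eq_class) (auto simp: gp_words_simps)
  then obtain w where w: "gp_reduces (u @ u') w" "gp_reduces (v @ v') w"
    using gp_eq_confluent by blast
  obtain c0 where c0: "cut c0" "outer c0 = u @ u'" "gp_eq V E G (lower c0) u"
    using ex_cut_of_product[OF u(1) u'(1)] by blast
  obtain c where c: "cut c" "outer c = w" "gp_eq V E G (lower c0) (lower c)"
    using cut_reduces[OF w(1) c0(1,2)] by blast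
  obtain d0 where d0: "cut d0" "outer d0 = v @ v'" "gp_eq V E G (lower d0) v"
    using ex_cut_of_product[OF v(1) v'(1)] by blast
  obtain d where d: "cut d" "outer d = w" "gp_eq V E G (lower d0) (lower d)"
    using cut_reduces[OF w(2) d0(1,2)] by blast
  have pc: "p = gp_class (lower c)"
    using gp_class_eq[OF c0(3)] gp_class_eq[OF c(3)] u by simp
  have qd: "q = gp_class (lower d)"
    using gp_class_eq[OF d0(3)] gp_class_eq[OF d(3)] v by simp
  have "\<forall>J\<in>V. \<forall>k<N J. m (J, k) \<le> weight (lower c) J k"
    using S[of "lower c"] pq(1) pc cut_words[OF c(1)] by blast
  moreover have "\<forall>J\<in>V. \<forall>k<N J. m (J, k) \<le> weight (lower d) J k"
    using S[of "lower d"] pq(2) qd cut_words[OF d(1)] by blast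
  ultimately obtain e e' where e: "cut e" "cut e'" "lower e = lower e'" "outer e = lower c"
      "outer e' = lower d" "\<forall>J\<in>V. \<forall>k<N J. m (J, k) \<le> weight (lower e) J k"
    using common_lower_cut[OF min c(1) d(1), of "\<lambda>J k. m (J, k)"] c(2) d(2) by auto
  \<comment> \<open>over an empty graph the generated subsemigroup is empty, but it contains \<open>p\<close>\<close>
  have "V \<noteq> {}"
  proof
    assume "V = {}"
    then have "A \<notin> subsemigroup_generated (graph_product V E G) {}" for A
      by (auto elim: subsemigroup_generated.induct)
    then show False
      using \<open>p \<in> ?C\<close> \<open>V = {}\<close> unfolding graph_product_cone_def by simp
  qed
  then obtain I where I: "I \<in> V" by blast
  have s: "gp_class (lower e) \<in> ?S"
    using S[of "lower e"] e(6) words_cone[OF I] cut_words[OF e(1)] by blast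
  have le: "ql_le (graph_product V E G) ?C (gp_class (lower e)) p"
    using ql_le_words[OF _ _ refl _ I, of "lower e" "upper e" p] cut_words[OF e(1)]
      gp_class_eq[OF cut_product[OF e(1)]] e(4) pc by auto
  have le': "ql_le (graph_product V E G) ?C (gp_class (lower e)) q"
    using ql_le_words[OF _ _ refl _ I, of "lower e'" "upper e'" q] cut_words[OF e(2)]
      gp_class_eq[OF cut_product[OF e(2)]] e(3,5) qd by auto
  show "p = q"
    using p q s le le' unfolding ql_minimal_def by metis
qed

end

theorem proposition6p3:
  fixes V :: "'v set" and E :: "('v \<times> 'v) set"
    and G :: "'v \<Rightarrow> ('a, 'b) monoid_scheme" and P :: "'v \<Rightarrow> 'a set"
    and N :: "'v \<Rightarrow> nat" and \<theta> :: "'v \<Rightarrow> 'a \<Rightarrow> nat \<Rightarrow> int"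
    and \<Theta> :: "('v \<times> 'a) list set \<Rightarrow> 'v \<times> nat \<Rightarrow> int"
  assumes "finite V" and "E \<subseteq> V \<times> V" and "sym E" and "irrefl E"
    and "\<And>I. I \<in> V \<Longrightarrow> quasi_lattice_ordered (G I) (P I)"
    and "\<And>I. I \<in> V \<Longrightarrow> controlled_map (G I) (P I) {..<N I} (\<theta> I)"
    and "\<And>I. I \<in> V \<Longrightarrow> minimality_property (G I) (P I) {..<N I} (\<theta> I)"
    and "completion_map V E G N \<theta> \<Theta>"
  shows "minimality_property (graph_product V E G) (graph_product_cone V E G P)
           (SIGMA I:V. {..<N I}) \<Theta>"
proof -
  have "group (G I)" if "I \<in> V" for I
    using quasi_lattice_ordered.axioms(1)[OF assms(5)[OF that]] .
  then interpret graph_of_controlled_maps V E G P N \<theta>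
    by (intro graph_of_controlled_maps.intro graph_of_quasi_lattices.intro graph_of_groups.intro
        group_family.intro graph_of_groups_axioms.intro graph_of_quasi_lattices_axioms.intro
        graph_of_controlled_maps_axioms.intro) (use assms in blast)+
  show ?thesis
    unfolding minimality_property_def
    using minimal_bounded_unique[OF assms(7,8)] by blast
qed

end
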